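(* Let $p$ be a prime number, let $q=p$ if $p$ is odd and $q=4$ if $p=2$. Let $\chi$ be an even Dirichlet character of conductor $f$, and let $F$ be a positive multiple of both $q$ and $f$. Let $c>1$ be an integer with $(c,F)=1$. For $a\in\mathbb{Z}$ define $$\epsilon_{a,c,F}=\frac{c-1}{2}-\{-aF^{-1}\}_c\in\left\{-\frac{c-1}{2},-\frac{c-1}{2}+1,\dots,\frac{c-1}{2}\right\}.$$ Then for every $s\in\mathbb{C}_p$ with $|s|<qp^{-1/(p-1)}$, $$-(1-\chi(c)\langle c\rangle^{1-s})\,L_p(s,\chi)=\sum_{\substack{a=1\\ p\nmid a}}^{F}\chi\omega^{-1}(a)\,\langle a\rangle^{-s}\,\epsilon_{a,c,F}+\delta(F/(qp)),$$ where $\delta(F/(qp))$ denotes a term (depending on $s$) of $p$-adic absolute value at most $|F/(qp)|$. (At $s=1$ the left-hand side is understood as the value of the analytic function $-(1-\chi(c)\langle c\rangle^{1-s})L_p(s,\chi)$ there, the singularity being removable when $\chi=1$.)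
   Context: $|\cdot|$ is the absolute value on $\mathbb{C}_p$ with $|p|=1/p$. Dirichlet characters are primitive and take values in $\mathbb{C}_p$ (via a fixed embedding of $\overline{\mathbb{Q}}$), with $\chi(a)=0$ if $(a,f)>1$. $\omega$ is the Teichmüller character of conductor $q$: for $p\nmid a$, $\omega(a)$ is the root of unity in $\mathbb{Z}_p$ (of order dividing $p-1$ if $p$ is odd, $\pm1$ if $p=2$) with $\omega(a)\equiv a \bmod q$. For $p\nmid a$, $\langle a\rangle=a/\omega(a)\in 1+q\mathbb{Z}_p$, $\chi\omega^{-1}(a)=\chi(a)\omega(a)^{-1}$, and $\langle a\rangle^{s}=\sum_{j\ge0}\binom{s}{j}(\langle a\rangle-1)^j$ for $|s|<qp^{-1/(p-1)}$. The $p$-adic $L$-function $L_p(s,\chi)$ is the meromorphic function on $\{s\in\mathbb{C}_p: |s|<qp^{-1/(p-1)}\}$ (analytic if $\chi\ne1$; for $\chi=1$ analytic except for a simple pole at $s=1$) characterized by $L_p(1-n,\chi)=-(1-\chi\omega^{-n}(p)p^{n-1})\frac{B_{n,\chi\omega^{-n}}}{n}$ for all integers $n\ge1$ (here $\chi\omega^{-n}$ denotes the associated primitive character and $B_{n,\psi}$ are generalized Bernoulli numbers). It is known to be given explicitly, for any positive multiple $F$ of $q$ and $f$, by $L_p(s,\chi)=\frac1F\frac1{s-1}\sum_{1\le a\le F,\,p\nmid a}\chi(a)\langle a\rangle^{1-s}\sum_{j\ge0}\binom{1-s}{j}(F/a)^jB_j$, where $B_j$ are the Bernoulli numbers ($B_1=-1/2$).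 For a positive integer $m$, $\{x\}_m$ denotes the unique representative of $x$ modulo $m$ in $\{0,1,\dots,m-1\}$; in $\{-aF^{-1}\}_c$, $F^{-1}$ is the inverse of $F$ modulo $c$. *)

theory Defs
  imports
    "HOL-Analysis.Analysis"
    "HOL-Computational_Algebra.Computational_Algebra"
    "HOL-Number_Theory.Modular_Inverse"
begin

section \<open>The field \<open>C_p\<close>\<close>

text \<open>
  The library constant norm is reserved for real normed vector spaces, so the absolute value of
  a field that is also a metric space is written as the distance to zero.
\<close>

abbreviation pabs :: "'a::{metric_space,zero} \<Rightarrow> real" where
  "pabs x \<equiv> dist x 0"

text \<open>
  The field \<open>C_p\<close> is the completion of an algebraic closure of \<open>Q_p\<close>, with \<open>|p| = 1/p\<close>.  This
  determines it up to isometric isomorphism, and the type \<open>'a\<close> ranges over all its models.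
  Completeness, algebraic closedness and characteristic zero are in the sort.  In a complete field
  with these absolute value axioms, \<open>Q_p\<close> is the closure of the rational numbers and \<open>Z_p\<close> the
  closure of the integers; the last condition says that the elements algebraic over \<open>Q_p\<close>
  are dense.
\<close>

definition is_Cp :: "nat \<Rightarrow> 'a::{alg_closed_field,field_char_0,complete_space} itself \<Rightarrow> bool" where
  "is_Cp p K \<longleftrightarrow>
     (\<forall>x y :: 'a. dist x y = pabs (x - y)) \<and>
     (\<forall>x y :: 'a. pabs (x * y) = pabs x * pabs y) \<and>
     (\<forall>x y :: 'a. pabs (x + y) \<le> max (pabs x) (pabs y)) \<and>
     pabs (of_nat p :: 'a) = 1 / real p \<and>
     closure {x :: 'a. \<exists>P. P \<noteq> 0 \<and> (\<forall>i. coeff P i \<in> closure \<rat>) \<and> poly P x = 0} = UNIV"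

definition padic_q :: "nat \<Rightarrow> nat" where
  "padic_q p = (if p = 2 then 4 else p)"

definition padic_radius :: "nat \<Rightarrow> real" where
  "padic_radius p = real (padic_q p) * real p powr (- 1 / (real p - 1))"

definition analytic_on_disc :: "real \<Rightarrow> ('a::{field,metric_space} \<Rightarrow> 'a) \<Rightarrow> bool" where
  "analytic_on_disc r g \<longleftrightarrow> (\<exists>u. \<forall>s. pabs s < r \<longrightarrow> (\<lambda>n. u n * s ^ n) sums g s)"

section \<open>Dirichlet characters\<close>

definition dirichlet_char :: "nat \<Rightarrow> (int \<Rightarrow> 'a::field) \<Rightarrow> bool" where
  "dirichlet_char m chi \<longleftrightarrow>
     m > 0 \<and>
     (\<forall>a b. [a = b] (mod int m) \<longrightarrow> chi a = chi b) \<and>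
     (\<forall>a b. chi (a * b) = chi a * chi b) \<and>
     (\<forall>a. chi a \<noteq> 0 \<longleftrightarrow> coprime a (int m))"

text \<open>
  The conductor of a possibly imprimitive character, and its associated primitive character.
  A character \<open>chi\<close> is primitive modulo \<open>f\<close> iff it is a character modulo \<open>f\<close> with conductor \<open>f\<close>.
\<close>

definition conductor :: "(int \<Rightarrow> 'a::field) \<Rightarrow> nat" where
  "conductor chi = (LEAST g. \<exists>\<psi>. dirichlet_char g \<psi> \<and> (\<forall>a. chi a \<noteq> 0 \<longrightarrow> \<psi> a = chi a))"

definition primitive_char :: "(int \<Rightarrow> 'a::field) \<Rightarrow> int \<Rightarrow> 'a" where
  "primitive_char chi =
     (THE \<psi>. dirichlet_char (conductor chi) \<psi> \<and> (\<forall>a. chi a \<noteq> 0 \<longrightarrow> \<psi> a = chi a))"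

section \<open>The Teichmueller character and the function \<open>\<langle>a\<rangle>\<^sup>s\<close>\<close>

definition teich :: "nat \<Rightarrow> int \<Rightarrow> 'a::{field_char_0,metric_space}" where
  "teich p a =
     (if int p dvd a then 0
      else THE x. x \<in> closure \<int> \<and> x ^ (if p = 2 then 2 else p - 1) = 1 \<and>
                  pabs (x - of_int a) \<le> pabs (of_nat (padic_q p) :: 'a))"

definition diamond :: "nat \<Rightarrow> int \<Rightarrow> 'a::{field_char_0,metric_space}" where
  "diamond p a = of_int a / teich p a"

definition diamond_pow :: "nat \<Rightarrow> int \<Rightarrow> 'a::{field_char_0,metric_space} \<Rightarrow> 'a" where
  "diamond_pow p a s = (\<Sum>j. (s gchoose j) * (diamond p a - 1) ^ j)"

text \<open>
  The primitive character associated with \<open>chi * \<omega>\<^sup>-\<^sup>n\<close>.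
  For \<open>n \<ge> 1\<close> the product inside vanishes at multiples of \<open>p\<close>, because \<open>inverse 0 = 0\<close>.
\<close>

definition char_twist ::
    "nat \<Rightarrow> (int \<Rightarrow> 'a::{field_char_0,metric_space}) \<Rightarrow> nat \<Rightarrow> int \<Rightarrow> 'a" where
  "char_twist p chi n = primitive_char (\<lambda>a. chi a * inverse (teich p a) ^ n)"

section \<open>Generalized Bernoulli numbers and the \<open>p\<close>-adic \<open>L\<close>-function\<close>

text \<open>
  For a primitive \<open>\<psi>\<close> of conductor \<open>m\<close>, the number with index \<open>n\<close> is \<open>n!\<close> times the coefficient
  of \<open>t\<^sup>n\<close> in the sum over \<open>1 \<le> a \<le> m\<close> of \<open>\<psi>(a) t exp(at) / (exp(mt) - 1)\<close>.
\<close>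

definition gen_bernoulli :: "nat \<Rightarrow> (int \<Rightarrow> 'a::field_char_0) \<Rightarrow> 'a" where
  "gen_bernoulli n \<psi> =
     fact n * fps_nth
       ((\<Sum>a = 1..conductor \<psi>. fps_const (\<psi> (int a)) * fps_X * fps_exp (of_nat a))
          / (fps_exp (of_nat (conductor \<psi>)) - 1)) n"

definition is_padic_L ::
    "nat \<Rightarrow> (int \<Rightarrow> 'a::{field_char_0,metric_space}) \<Rightarrow> ('a \<Rightarrow> 'a) \<Rightarrow> bool" where
  "is_padic_L p chi L \<longleftrightarrow>
     (if chi \<noteq> (\<lambda>_. 1) then analytic_on_disc (padic_radius p) L
      else \<exists>h. analytic_on_disc (padic_radius p) h \<and> h 1 \<noteq> 0 \<and>
               (\<forall>s. pabs s < padic_radius p \<and> s \<noteq> 1 \<longrightarrow> L s = h s / (s - 1))) \<and>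
     (\<forall>n\<ge>1. L (1 - of_nat n) =
        - (1 - char_twist p chi n (int p) * of_nat p ^ (n - 1))
          * (gen_bernoulli n (char_twist p chi n) / of_nat n))"

text \<open>
  These properties determine the values on the disc of radius \<open>padic_radius p\<close>, apart from the pole
  at \<open>1\<close> when \<open>chi\<close> is trivial; the remaining values are irrelevant.
\<close>

definition padic_L ::
    "nat \<Rightarrow> 'a \<Rightarrow> (int \<Rightarrow> 'a::{field_char_0,metric_space}) \<Rightarrow> 'a" where
  "padic_L p s chi = (SOME L. is_padic_L p chi L) s"

definition eps :: "int \<Rightarrow> nat \<Rightarrow> nat \<Rightarrow> rat" where
  "eps a c F =
     (of_nat c - 1) / 2 - of_int ((- a * modular_inverse (int c) (int F)) mod int c)"

end

(*
The explicit formula writes (s - 1) L_p(s, chi) as F^-1 times the sum over a of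
chi(a) <a>^(1-s) I((1 + F x / a)^(1-s)), where I is the functional that sends x^j to the Bernoulli number B_j.
Multiplying by chi(c) <c>^(1-s) amounts to replacing a by b = c a - F k, with 0 <= k < c, that is
k = {-b / F}_c, and x^j by (k + c x)^j.  So in the difference of the two expressions the coefficient B_j
becomes c^j B_j(k / c) - B_j, which is 0 for j = 0 and -eps for j = 1; the term j = 1 is the sum in the
theorem, and von Staudt's bound |B_j| <= p makes all later terms at most |F / (q p)|.
All identities between analytic functions are checked at the points 1 - n, where every series is a finite
sum; the points -p^k tend to 0, so this is enough.
*)

theory Submission
  imports Defs "HOL-Combinatorics.Stirling" "HOL-Number_Theory.Residues"
begin

section \<open>Ultrametric series and analytic functions\<close>

text \<open>The binomial coefficient of 1 - s over j + 1 is (1 - s) / (j + 1) times that of -s over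
  j, so a series in these coefficients without a term j = 0 can be divided by 1 - s term by term.
  The extra 1 / (j + 1) costs nothing, because the valuation of (j + 1)! is at most j / (p - 1).
  This is why everything converges on the full disc of radius q p^(-1/(p-1)), and why a bound C /
  q^j on the coefficients bounds the sum by C. Two obstacles lie outside the analysis.
  \<open>padic_L\<close> is defined by a choice, so a function with the interpolation property must
  be built, and for nontrivial chi this includes a proof that the residue at 1 vanishes. Moreover,
  interpolation is stated for primitive characters, while the explicit formula contains the plain
  product of chi with a power of the Teichmueller character. The two have to be compared at
  arguments prime to p; the Euler factor accounts for the multiples of p.\<close>

locale padic_field =
  fixes p :: nat and K :: "'a::{field_char_0,complete_space} itself"
  assumes prime_p: "prime p"
    and dist_diff: "\<And>x y :: 'a. dist x y = pabs (x - y)"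
    and pabs_mult: "\<And>x y :: 'a. pabs (x * y) = pabs x * pabs y"
    and pabs_add: "\<And>x y :: 'a. pabs (x + y) \<le> max (pabs x) (pabs y)"
    and pabs_p: "pabs (of_nat p :: 'a) = 1 / real p"
begin

section \<open>Elementary properties of the absolute value\<close>

lemma pabs_one: "pabs (1::'a) = 1"
proof -
  have "pabs (1::'a) * pabs (1::'a) = pabs (1::'a) * 1" using pabs_mult[of 1 1] by simp
  moreover have "pabs (1::'a) \<noteq> 0" by simp
  ultimately show ?thesis by (metis mult_cancel_left)
qed

lemma pabs_minus: "pabs (- x :: 'a) = pabs x"
  using dist_diff[of 0 x] by (simp add: dist_commute)

lemma pabs_diff: "pabs (x - y :: 'a) \<le> max (pabs x) (pabs y)"
  using pabs_add[of x "- y"] by (simp add: pabs_minus)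

lemma pabs_diff_commute: "pabs (x - y :: 'a) = pabs (y - x)"
  using pabs_minus[of "x - y"] by simp

lemma pabs_power: "pabs (x ^ n :: 'a) = pabs x ^ n"
  by (induction n) (auto simp: pabs_one pabs_mult)

lemma pabs_inverse: "pabs (inverse x :: 'a) = inverse (pabs x)"
proof (cases "x = 0")
  case False
  then have "pabs x * pabs (inverse x) = 1" by (simp add: pabs_one flip: pabs_mult)
  then show ?thesis by (simp add: inverse_unique)
qed simp

lemma pabs_divide: "pabs (x / y :: 'a) = pabs x / pabs y"
  by (simp add: divide_inverse pabs_mult pabs_inverse)

lemma pabs_sum_le:
  assumes "\<And>i. i \<in> A \<Longrightarrow> pabs (f i :: 'a) \<le> C" "C \<ge> 0"
  shows "pabs (sum f A) \<le> C"
  using assms(1)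
proof (induction A rule: infinite_finite_induct)
  case (insert x A)
  then have "max (pabs (f x)) (pabs (sum f A)) \<le> C" by simp
  then show ?case 
    using order_trans[OF pabs_add[of "f x" "sum f A"]] insert.hyps by simp
qed (use assms(2) in auto)

lemma pabs_of_nat: "pabs (of_nat n :: 'a) \<le> 1"
  using pabs_sum_le[of "{..<n}" "\<lambda>_. 1::'a" 1] by (simp add: pabs_one)

lemma pabs_of_int: "pabs (of_int n :: 'a) \<le> 1"
  by (cases n rule: int_cases2) (simp_all add: pabs_of_nat pabs_minus)

text \<open>In a Bezout relation \<open>u * n + v * p = 1\<close> the term with \<open>p\<close> has
  absolute value below 1, so the other one must reach 1.\<close>

lemma pabs_of_int_coprime:
  assumes "\<not> int p dvd n"
  shows "pabs (of_int n :: 'a) = 1"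
proof -
  have "coprime n (int p)"
    using prime_imp_coprime[of "int p" n] assms prime_p by (simp add: coprime_commute)
  then obtain u v where "u * n + v * int p = 1"
    by (metis bezout_int coprime_imp_gcd_eq_1)
  then have "(1::'a) = of_int u * of_int n + of_int v * of_nat p"
    by (metis of_int_1 of_int_add of_int_mult of_int_of_nat_eq)
  then have "1 \<le> max (pabs (of_int u * of_int n :: 'a)) (pabs (of_int v * of_nat p :: 'a))"
    by (metis pabs_add pabs_one)
  moreover have "pabs (of_int v * of_nat p :: 'a) < 1"
  proof -
    have "pabs (of_int v * of_nat p :: 'a) \<le> 1 * (1 / real p)"
      unfolding pabs_mult pabs_p by (intro mult_right_mono pabs_of_int) auto
    also have "\<dots> < 1" using prime_gt_1_nat[OF prime_p] by simp
    finally show ?thesis .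
  qed
  ultimately have "1 \<le> pabs (of_int u :: 'a) * pabs (of_int n :: 'a)" by (simp add: pabs_mult)
  also have "\<dots> \<le> 1 * pabs (of_int n :: 'a)" by (intro mult_right_mono pabs_of_int) auto
  finally show ?thesis using pabs_of_int[of n] by simp
qed

lemma pabs_of_nat_coprime: "\<not> p dvd n \<Longrightarrow> pabs (of_nat n :: 'a) = 1"
  using pabs_of_int_coprime[of "int n"] by simp

lemma pabs_of_int_dvd:
  assumes "int m dvd n"
  shows "pabs (of_int n :: 'a) \<le> pabs (of_nat m :: 'a)"
proof -
  obtain k where "n = int m * k" using assms ..
  then show ?thesis by (simp add: pabs_mult mult_left_le pabs_of_int)
qed

section \<open>Limits and series\<close>

lemma tendsto_pabs_iff: "(X \<longlonglongrightarrow> (L::'a)) \<longleftrightarrow> (\<lambda>n. pabs (X n - L)) \<longlonglongrightarrow> 0"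
  unfolding tendsto_dist_iff[of X] by (simp flip: dist_diff)

lemma sums_pabs_iff: "f sums (s::'a) \<longleftrightarrow> (\<lambda>n. pabs ((\<Sum>i<n. f i) - s)) \<longlonglongrightarrow> 0"
  unfolding sums_def by (rule tendsto_pabs_iff)

text \<open>The sort provides a metric but no continuity of the field operations; it is derived from
  the ultrametric axioms by passing to real null sequences.\<close>

lemma tendsto_add_padic:
  assumes "X \<longlonglongrightarrow> (a::'a)" "Y \<longlonglongrightarrow> b"
  shows "(\<lambda>n. X n + Y n) \<longlonglongrightarrow> a + b"
  unfolding tendsto_pabs_iff
proof (rule tendsto_sandwich[of "\<lambda>_. 0" _ _ "\<lambda>n. pabs (X n - a) + pabs (Y n - b)"])
  show "(\<lambda>n. pabs (X n - a) + pabs (Y n - b)) \<longlonglongrightarrow> 0"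
    using tendsto_add[OF assms[unfolded tendsto_pabs_iff]] by simp
  have "pabs (X n + Y n - (a + b)) \<le> pabs (X n - a) + pabs (Y n - b)" for n
  proof -
    have "pabs ((X n - a) + (Y n - b)) \<le> max (pabs (X n - a)) (pabs (Y n - b))" by (rule pabs_add)
    also have "\<dots> \<le> pabs (X n - a) + pabs (Y n - b)" by (simp only: max.bounded_iff) simp
    finally show ?thesis by (simp only: add_diff_add)
  qed
  then show "\<forall>\<^sub>F n in sequentially. pabs (X n + Y n - (a + b)) \<le> pabs (X n - a) + pabs (Y n - b)"
    by simp
qed auto

lemma tendsto_cmult_padic:
  assumes "X \<longlonglongrightarrow> (a::'a)"
  shows "(\<lambda>n. c * X n) \<longlonglongrightarrow> c * a"
  using tendsto_mult_left[OF assms[unfolded tendsto_pabs_iff], of "pabs c"]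
  unfolding tendsto_pabs_iff by (simp add: pabs_mult flip: right_diff_distrib)

lemma tendsto_pabs_le:
  assumes "X \<longlonglongrightarrow> (a::'a)" "\<And>n. pabs (X n - b) \<le> C"
  shows "pabs (a - b) \<le> C"
proof (rule Lim_bounded)
  show "(\<lambda>n. dist (X n) b) \<longlonglongrightarrow> pabs (a - b)"
    unfolding dist_diff[of a b, symmetric] by (intro tendsto_intros assms)
qed (use assms(2) dist_diff[of _ b] in auto)

lemma sums_add_padic: "f sums (a::'a) \<Longrightarrow> g sums b \<Longrightarrow> (\<lambda>n. f n + g n) sums (a + b)"
  unfolding sums_def by (simp add: sum.distrib tendsto_add_padic)

lemma sums_cmult_padic: "f sums (a::'a) \<Longrightarrow> (\<lambda>n. c * f n) sums (c * a)"
  unfolding sums_def using tendsto_cmult_padic by (simp flip: sum_distrib_left)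

lemma sums_minus_padic: "f sums (a::'a) \<Longrightarrow> (\<lambda>n. - f n) sums (- a)"
  using sums_cmult_padic[of f a "-1"] by simp

lemma sums_diff_padic: "f sums (a::'a) \<Longrightarrow> g sums b \<Longrightarrow> (\<lambda>n. f n - g n) sums (a - b)"
  using sums_add_padic[of f a "\<lambda>n. - g n" "- b"] sums_minus_padic[of g b] by simp

lemma sums_sum_padic:
  assumes "\<And>i. i \<in> A \<Longrightarrow> f i sums (s i :: 'a)"
  shows "(\<lambda>n. \<Sum>i\<in>A. f i n) sums (\<Sum>i\<in>A. s i)"
  using assms by (induction A rule: infinite_finite_induct) (auto intro: sums_add_padic)

lemma sums_le_padic:
  assumes "f sums (s::'a)" "\<And>n. pabs (f n) \<le> C"
  shows "pabs s \<le> C"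
proof -
  have "C \<ge> 0" using assms(2)[of 0] zero_le_dist order_trans by blast
  then show ?thesis
    using tendsto_pabs_le[of "\<lambda>n. \<Sum>i<n. f i" s 0 C] assms pabs_sum_le[of _ f C]
    unfolding sums_def by auto
qed

lemma sums_head_padic:
  assumes "(\<lambda>n. f (n + k)) sums (s::'a)"
  shows "f sums ((\<Sum>i<k. f i) + s)"
proof -
  have "(\<Sum>i<n + k. f i) = (\<Sum>i<k. f i) + (\<Sum>i<n. f (i + k))" for n
    by (induction n) (auto simp: algebra_simps)
  moreover have "(\<lambda>n. (\<Sum>i<k. f i) + (\<Sum>i<n. f (i + k))) \<longlonglongrightarrow> (\<Sum>i<k. f i) + s"
    using assms unfolding sums_def by (intro tendsto_add_padic tendsto_const)
  ultimately show ?thesis unfolding sums_def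
    using LIMSEQ_offset[of "\<lambda>n. \<Sum>i<n. f i" k] by simp
qed

lemma sums_tail_padic:
  assumes "f sums (s::'a)"
  shows "(\<lambda>n. f (n + k)) sums (s - (\<Sum>i<k. f i))"
proof -
  have "(\<lambda>n. (\<Sum>i<n + k. f i) + - (\<Sum>i<k. f i)) \<longlonglongrightarrow> s + - (\<Sum>i<k. f i)"
    using assms unfolding sums_def
    by (intro tendsto_add_padic tendsto_const LIMSEQ_ignore_initial_segment)
  moreover have "(\<Sum>i<n + k. f i) + - (\<Sum>i<k. f i) = (\<Sum>i<n. f (i + k))" for n
    by (induction n) (auto simp: algebra_simps)
  ultimately show ?thesis unfolding sums_def by simp
qed

lemma sums_imp_tendsto_0:
  assumes "f sums (s::'a)"
  shows "(\<lambda>n. pabs (f n)) \<longlonglongrightarrow> 0"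
proof -
  have *: "(\<lambda>n. \<Sum>i<n. f i) \<longlonglongrightarrow> s" using assms unfolding sums_def .
  have "(\<lambda>n. (\<Sum>i<Suc n. f i) + (-1) * (\<Sum>i<n. f i)) \<longlonglongrightarrow> s + (-1) * s"
    by (intro tendsto_add_padic tendsto_cmult_padic * LIMSEQ_Suc[OF *])
  then show ?thesis using tendsto_pabs_iff[of f 0] by simp
qed

text \<open>In an ultrametric field null terms suffice: a block of the series is bounded by its
  largest term, so the partial sums are Cauchy.\<close>

lemma summable_padic:
  assumes "(\<lambda>n. pabs (f n :: 'a)) \<longlonglongrightarrow> 0"
  shows "summable f"
proof -
  have "Cauchy (\<lambda>n. \<Sum>i<n. f i)"
    unfolding Cauchy_altdef
  proof (intro allI impI)
    fix e :: real assume "e > 0"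
    then have "e / 2 > 0" by simp
    from order_tendstoD(2)[OF assms this] obtain N where N: "\<And>n. n \<ge> N \<Longrightarrow> pabs (f n) < e / 2"
      by (auto simp: eventually_at_top_linorder)
    have "dist (\<Sum>i<m. f i) (\<Sum>i<n. f i) < e" if "m \<ge> N" "n > m" for m n
    proof -
      have "(\<Sum>i<n. f i) = (\<Sum>i<m. f i) + (\<Sum>i\<in>{m..<n}. f i)"
        using that by (metis atLeast0LessThan le0 less_imp_le sum.atLeastLessThan_concat)
      then have "dist (\<Sum>i<m. f i) (\<Sum>i<n. f i) = pabs (\<Sum>i\<in>{m..<n}. f i)"
        by (subst dist_diff) (simp add: pabs_minus)
      also have "\<dots> \<le> e / 2" using that N \<open>e > 0\<close> by (intro pabs_sum_le) (auto simp: less_imp_le)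
      finally show ?thesis using \<open>e > 0\<close> by simp
    qed
    then show "\<exists>M. \<forall>m\<ge>M. \<forall>n>m. dist (\<Sum>i<m. f i) (\<Sum>i<n. f i) < e" by blast
  qed
  then show ?thesis
    by (simp add: Cauchy_convergent_iff summable_iff_convergent)
qed

text \<open>The smallness is uniform in the rows. Once the first \<open>m\<close> columns are
  removed, every row has a remainder of size at most \<open>e / 2\<close>, and by the ultrametric
  inequality so has the sum of these remainders.\<close>

lemma sums_swap_padic:
  fixes a :: "nat \<Rightarrow> nat \<Rightarrow> 'a"
  assumes rows: "\<And>i. a i sums r i" and cols: "\<And>j. (\<lambda>i. a i j) sums c j"
    and total: "r sums s"
    and small: "\<And>e. e > 0 \<Longrightarrow> \<exists>N. \<forall>i. \<forall>j\<ge>N. pabs (a i j) \<le> e"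
  shows "c sums s"
  unfolding sums_pabs_iff
proof (rule LIMSEQ_I)
  fix e :: real assume "e > 0"
  then obtain N where N: "\<And>i j. j \<ge> N \<Longrightarrow> pabs (a i j) \<le> e / 2" using small[of "e / 2"] by auto
  have "pabs ((\<Sum>j<m. c j) - s) < e" if "m \<ge> N" for m
  proof -
    have "(\<lambda>i. r i - (\<Sum>j<m. a i j)) sums (s - (\<Sum>j<m. c j))"
      by (intro sums_diff_padic total sums_sum_padic cols)
    moreover have "pabs (r i - (\<Sum>j<m. a i j)) \<le> e / 2" for i
      using that by (intro sums_le_padic[OF sums_tail_padic[OF rows]] N) simp
    ultimately have "pabs (s - (\<Sum>j<m. c j)) \<le> e / 2" by (rule sums_le_padic)
    then show ?thesis using \<open>e > 0\<close> pabs_diff_commute[of s] by simp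
  qed
  then show "\<exists>no. \<forall>n\<ge>no. norm (pabs ((\<Sum>i<n. c i) - s) - 0) < e" by auto
qed

lemma tendsto_0_bounded:
  assumes "(\<lambda>n. pabs (f n :: 'a)) \<longlonglongrightarrow> 0"
  obtains C where "C > 0" "\<And>n. pabs (f n) \<le> C"
proof -
  have "Bseq (\<lambda>n. pabs (f n))" using assms convergent_imp_Bseq convergent_def by blast
  then show ?thesis using that by (auto elim!: BseqE)
qed

lemma sums_Cauchy_product_padic:
  assumes x: "x sums (X::'a)" and y: "y sums Y"
  shows "(\<lambda>n. \<Sum>i\<le>n. x i * y (n - i)) sums (X * Y)"
proof -
  \<comment> \<open>Row \<open>i\<close> is \<open>x i\<close> times the series \<open>y\<close>
    delayed by \<open>i\<close> places, so the columns are the finite convolutions. An entry far to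
    the right has either a large \<open>i\<close> or a large \<open>m - i\<close>.\<close>
  define a where "a = (\<lambda>i m. if i \<le> m then x i * y (m - i) else 0)"
  obtain A where A: "A > 0" "\<And>n. pabs (x n) \<le> A" using tendsto_0_bounded sums_imp_tendsto_0[OF x] by blast
  obtain B where B: "B > 0" "\<And>n. pabs (y n) \<le> B" using tendsto_0_bounded sums_imp_tendsto_0[OF y] by blast
  have "(\<lambda>m. \<Sum>i\<le>m. x i * y (m - i)) sums (X * Y)"
  proof (rule sums_swap_padic[of a "\<lambda>i. x i * Y"])
    show "a i sums (x i * Y)" for i
    proof -
      have "(\<lambda>m. a i (m + i)) sums (x i * Y)" unfolding a_def using sums_cmult_padic[OF y] by simp
      from sums_head_padic[OF this] show ?thesis by (simp add: a_def)
    qed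
    show "(\<lambda>i. a i m) sums (\<Sum>i\<le>m. x i * y (m - i))" for m
      using sums_finite[of "{..m}" "\<lambda>i. a i m"] by (simp add: a_def)
    show "(\<lambda>i. x i * Y) sums (X * Y)" using sums_cmult_padic[OF x, of Y] by (simp add: mult.commute)
    fix e :: real assume e: "e > 0"
    from order_tendstoD(2)[OF sums_imp_tendsto_0[OF x], of "e / B"] obtain N where
      N: "\<And>n. n \<ge> N \<Longrightarrow> pabs (x n) < e / B" using e B by (auto simp: eventually_at_top_linorder)
    from order_tendstoD(2)[OF sums_imp_tendsto_0[OF y], of "e / A"] obtain M where
      M: "\<And>n. n \<ge> M \<Longrightarrow> pabs (y n) < e / A" using e A by (auto simp: eventually_at_top_linorder)
    have "pabs (a i m) \<le> e" if "m \<ge> N + M" for i m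
    proof (cases "i \<le> m")
      case True
      consider "i \<ge> N" | "m - i \<ge> M" using \<open>m \<ge> N + M\<close> by linarith
      then have "pabs (x i) * pabs (y (m - i)) \<le> e"
      proof cases
        case 1
        then have "pabs (x i) * pabs (y (m - i)) \<le> (e / B) * B" using N B e
          by (intro mult_mono less_imp_le[OF N] B) auto
        then show ?thesis using B by simp
      next
        case 2
        then have "pabs (x i) * pabs (y (m - i)) \<le> A * (e / A)" using M A e
          by (intro mult_mono less_imp_le[OF M] A) auto
        then show ?thesis using A by simp
      qed
      then show ?thesis by (simp add: a_def True pabs_mult)
    qed (use e in \<open>simp add: a_def\<close>)
    then show "\<exists>N. \<forall>i. \<forall>m\<ge>N. pabs (a i m) \<le> e" by blast
  qed
  then show ?thesis .
qed

section \<open>Functions given by a power series on a disc\<close>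

lemma analytic_cong:
  assumes "analytic_on_disc r (f :: 'a \<Rightarrow> 'a)" "\<And>s. pabs s < r \<Longrightarrow> f s = g s"
  shows "analytic_on_disc r g"
  using assms unfolding analytic_on_disc_def by auto

lemma analytic_const: "analytic_on_disc r (\<lambda>_. c::'a)"
  unfolding analytic_on_disc_def
proof (intro exI allI impI)
  fix s :: 'a
  show "(\<lambda>n. (if n = 0 then c else 0) * s ^ n) sums c"
    using sums_finite[of "{0}" "\<lambda>n. (if n = 0 then c else 0) * s ^ n"] by simp
qed

lemma analytic_ident: "analytic_on_disc r (\<lambda>s. s::'a)"
  unfolding analytic_on_disc_def
proof (intro exI allI impI)
  fix s :: 'a
  show "(\<lambda>n. (if n = 1 then 1 else 0) * s ^ n) sums s"
    using sums_finite[of "{1}" "\<lambda>n. (if n = 1 then 1 else 0) * s ^ n"] by simp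
qed

lemma analytic_add:
  assumes "analytic_on_disc r (f :: 'a \<Rightarrow> 'a)" "analytic_on_disc r g"
  shows "analytic_on_disc r (\<lambda>s. f s + g s)"
proof -
  obtain u v where "\<forall>s. pabs s < r \<longrightarrow> (\<lambda>n. u n * s ^ n) sums f s"
    "\<forall>s. pabs s < r \<longrightarrow> (\<lambda>n. v n * s ^ n) sums g s"
    using assms unfolding analytic_on_disc_def by blast
  then have "\<forall>s. pabs s < r \<longrightarrow> (\<lambda>n. (u n + v n) * s ^ n) sums (f s + g s)"
    by (auto simp: distrib_right intro: sums_add_padic)
  then show ?thesis unfolding analytic_on_disc_def by (rule exI[of _ "\<lambda>n. u n + v n"])
qed

lemma analytic_mult:
  assumes "analytic_on_disc r (f :: 'a \<Rightarrow> 'a)" "analytic_on_disc r g"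
  shows "analytic_on_disc r (\<lambda>s. f s * g s)"
proof -
  obtain u v where *: "\<And>s. pabs s < r \<Longrightarrow> (\<lambda>n. u n * s ^ n) sums f s"
    "\<And>s. pabs s < r \<Longrightarrow> (\<lambda>n. v n * s ^ n) sums g s"
    using assms unfolding analytic_on_disc_def by blast
  have "(\<lambda>n. (\<Sum>i\<le>n. u i * v (n - i)) * s ^ n) sums (f s * g s)" if "pabs s < r" for s
  proof -
    have "(\<Sum>i\<le>n. u i * v (n - i)) * s ^ n = (\<Sum>i\<le>n. u i * s ^ i * (v (n - i) * s ^ (n - i)))" for n
      unfolding sum_distrib_right
      by (intro sum.cong refl) (simp add: mult_ac flip: power_add)
    then show ?thesis using sums_Cauchy_product_padic[OF *(1)[OF that] *(2)[OF that]] by simp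
  qed
  then show ?thesis unfolding analytic_on_disc_def
    by (intro exI[of _ "\<lambda>n. \<Sum>i\<le>n. u i * v (n - i)"]) blast
qed

lemma analytic_cmult: "analytic_on_disc r (f :: 'a \<Rightarrow> 'a) \<Longrightarrow> analytic_on_disc r (\<lambda>s. c * f s)"
  by (intro analytic_mult analytic_const)

lemma analytic_diff:
  "analytic_on_disc r (f :: 'a \<Rightarrow> 'a) \<Longrightarrow> analytic_on_disc r g \<Longrightarrow> analytic_on_disc r (\<lambda>s. f s - g s)"
  using analytic_add[of r f "\<lambda>s. (-1) * g s"] analytic_cmult[of r g "-1"] by simp

lemma analytic_sum:
  "(\<And>i. i \<in> A \<Longrightarrow> analytic_on_disc r (f i :: 'a \<Rightarrow> 'a)) \<Longrightarrow> analytic_on_disc r (\<lambda>s. \<Sum>i\<in>A. f i s)"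
  by (induction A rule: infinite_finite_induct) (auto intro: analytic_add analytic_const)

text \<open>The points \<open>1 - n\<close> with \<open>n = p\<^sup>k + 1\<close> tend to \<open>0\<close>, so they determine every Taylor coefficient.\<close>

lemma analytic_eqI:
  assumes f: "analytic_on_disc r (f :: 'a \<Rightarrow> 'a)" and g: "analytic_on_disc r g" and r: "r > 1"
    and eq: "\<And>n. n \<ge> 1 \<Longrightarrow> f (1 - of_nat n) = g (1 - of_nat n)"
    and s: "pabs s < r"
  shows "f s = g s"
proof -
  obtain u where u: "\<And>s. pabs s < r \<Longrightarrow> (\<lambda>n. u n * s ^ n) sums (f s - g s)"
    using analytic_diff[OF f g] unfolding analytic_on_disc_def by blast
  \<comment> \<open>The disc contains 1, so convergence there bounds all the coefficients.\<close>
  have "(\<lambda>n. u n * 1 ^ n) sums (f 1 - g 1)" using r by (intro u) (simp add: pabs_one)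
  then obtain C where C: "C > 0" "\<And>n. pabs (u n) \<le> C"
    using tendsto_0_bounded[of u] sums_imp_tendsto_0 by auto
  have "u n = 0" for n
  proof (induction n rule: less_induct)
    case (less n)
    have "pabs (u n) \<le> C * (1 / real p) ^ k" for k
    proof -
      define t :: 'a where "t = - of_nat (p ^ k)"
      have t: "pabs t = (1 / real p) ^ k" by (simp add: t_def pabs_minus pabs_power pabs_p)
      have "t \<noteq> 0" using prime_p by (auto simp: t_def prime_gt_0_nat)
      have t1: "pabs t \<le> 1" unfolding t
        using prime_gt_1_nat[OF prime_p] by (intro power_le_one) auto
      then have "(\<lambda>m. u m * t ^ m) sums (f t - g t)" using r by (intro u) simp
      moreover have "f t = g t" using eq[of "p ^ k + 1"] by (simp add: t_def)
      ultimately have "(\<lambda>m. u m * t ^ m) sums 0" by simp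
      \<comment> \<open>The coefficients below \<open>n\<close> vanish by induction, so the
        \<open>n\<close>-th term is minus the rest of the series, which has an additional factor
        \<open>t\<close>.\<close>
      from sums_tail_padic[OF this, of "Suc n"]
      have "(\<lambda>m. u (m + Suc n) * t ^ (m + Suc n)) sums (- (u n * t ^ n))"
        using less by simp
      moreover have "pabs (u (m + Suc n) * t ^ (m + Suc n)) \<le> C * pabs t ^ Suc n" for m
        unfolding pabs_mult pabs_power using C t1
        by (intro mult_mono power_decreasing) auto
      ultimately have "pabs (- (u n * t ^ n)) \<le> C * pabs t ^ Suc n" by (rule sums_le_padic)
      then have "pabs (u n) * pabs t ^ n \<le> (C * pabs t) * pabs t ^ n"
        by (simp add: pabs_minus pabs_mult pabs_power mult_ac)
      moreover have "pabs t ^ n > 0" using \<open>t \<noteq> 0\<close> by simp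
      ultimately have "pabs (u n) \<le> C * pabs t" by (rule mult_right_le_imp_le)
      then show ?thesis by (simp add: t)
    qed
    moreover have "(\<lambda>k. C * (1 / real p) ^ k) \<longlonglongrightarrow> C * 0"
      using prime_gt_1_nat[OF prime_p] by (intro tendsto_mult tendsto_const LIMSEQ_realpow_zero) auto
    ultimately have "pabs (u n) \<le> 0" by (intro LIMSEQ_le_const[of _ "C * 0", simplified]) auto
    then show ?case by simp
  qed
  then have "(\<lambda>_. 0) sums (f s - g s)" using u[OF s] by simp
  then show ?thesis using sums_unique2[OF sums_zero] by fastforce
qed

end

section \<open>Binomial series\<close>

context padic_field
begin

text \<open>Only the multiples of \<open>p\<close> up to \<open>n\<close> matter, and these are
  \<open>p\<close> times the numbers from 1 to \<open>n div p\<close>.\<close>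

lemma pabs_fact_div: "pabs (fact n :: 'a) = (1 / real p) ^ (n div p) * pabs (fact (n div p) :: 'a)"
proof (induction n)
  case (Suc n)
  show ?case
  proof (cases "p dvd Suc n")
    case True
    then have "Suc n div p = Suc (n div p)" by (auto simp: div_Suc mod_eq_0_iff_dvd)
    moreover from this True have "Suc n = p * Suc (n div p)" by (metis dvd_mult_div_cancel)
    then have "(of_nat (Suc n) :: 'a) = of_nat p * of_nat (Suc (n div p))" by (metis of_nat_mult)
    ultimately show ?thesis using Suc by (simp add: pabs_mult pabs_p del: of_nat_Suc)
  next
    case False
    then have "Suc n div p = n div p" by (simp add: div_Suc mod_eq_0_iff_dvd)
    then show ?thesis using Suc False
      by (simp add: pabs_mult pabs_of_nat_coprime del: of_nat_Suc)
  qed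
qed (simp add: pabs_one)

text \<open>Legendre: the valuation of n! is (n - S) / (p - 1), where S is the digit sum of n in
  base p, and S is at least 1 for n > 0. The induction replaces \<open>n\<close> by
  \<open>n div p\<close>.\<close>

lemma pabs_fact: "\<exists>v. pabs (fact n :: 'a) = (1 / real p) ^ v \<and> v * (p - 1) \<le> n - 1"
proof (induction n rule: less_induct)
  case (less n)
  show ?case
  proof (cases "n < p")
    case True
    then show ?thesis using pabs_fact_div[of n] by (intro exI[of _ 0]) (simp add: pabs_one)
  next
    case False
    define m where "m = n div p"
    have p: "p > 1" using prime_gt_1_nat[OF prime_p] .
    then have "m < n" "m \<ge> 1" using False by (auto simp: m_def div_greater_zero_iff Suc_le_eq)
    from less[OF \<open>m < n\<close>] obtain v where v: "pabs (fact m :: 'a) = (1 / real p) ^ v" "v * (p - 1) \<le> m - 1"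
      by blast
    have "m * (p - 1) + m = m * p" using p by (cases p) auto
    moreover have "m * p \<le> n" by (simp add: m_def)
    ultimately have "(m + v) * (p - 1) \<le> n - 1" using v(2) \<open>m \<ge> 1\<close> by (simp add: algebra_simps)
    then show ?thesis using pabs_fact_div[of n] v(1)
      by (intro exI[of _ "m + v"]) (simp add: power_add flip: m_def)
  qed
qed

text \<open>The gain from \<open>n - 1\<close> instead of \<open>n\<close> in
  \<open>pabs_fact\<close> absorbs the extra factor \<open>j + 1\<close> of the factorial.\<close>

lemma pabs_inverse_fact_Suc: "pabs (1 / fact (Suc j) :: 'a) \<le> (real p powr (1 / (real p - 1))) ^ j"
proof -
  have p: "p > 1" using prime_gt_1_nat[OF prime_p] .
  obtain v where v: "pabs (fact (Suc j) :: 'a) = (1 / real p) ^ v" "v * (p - 1) \<le> j"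
    using pabs_fact[of "Suc j"] by auto
  have "real v * (real p - 1) \<le> real j" using v(2) p
    by (metis of_nat_1 of_nat_diff of_nat_le_iff of_nat_mult less_imp_le)
  then have le: "real v \<le> 1 / (real p - 1) * real j" using p by (simp add: field_simps)
  have "pabs (1 / fact (Suc j) :: 'a) = real p powr real v"
    using p by (simp add: pabs_divide pabs_one v(1) power_one_over powr_realpow del: fact_Suc)
  also have "\<dots> \<le> real p powr (1 / (real p - 1) * real j)" using p le by (intro powr_mono) auto
  also have "\<dots> = (real p powr (1 / (real p - 1))) ^ j"
    unfolding powr_powr[symmetric] using p by (intro powr_realpow) simp
  finally show ?thesis .
qed

lemma padic_q_pos: "padic_q p > 0"
  using prime_gt_0_nat[OF prime_p] by (simp add: padic_q_def)

lemma padic_radius_eq: "padic_radius p * real p powr (1 / (real p - 1)) = real (padic_q p)"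
proof -
  have "real p powr (- 1 / (real p - 1)) * real p powr (1 / (real p - 1)) = real p powr 0"
    unfolding powr_add[symmetric] by simp
  then show ?thesis using prime_gt_0_nat[OF prime_p] by (simp add: padic_radius_def mult.assoc)
qed

text \<open>It places the pole 1 and all the points 1 - n inside the disc. For odd p the radius is p
  to the positive power 1 - 1 / (p - 1); for p = 2 it is 2.\<close>

lemma padic_radius_gt_1: "padic_radius p > 1"
proof (cases "p = 2")
  case True
  then show ?thesis by (simp add: padic_radius_def padic_q_def powr_minus)
next
  case False
  then have p: "p > 2" using prime_ge_2_nat[OF prime_p] by linarith
  have "(1::real) = real p powr 0" using p by simp
  also have "\<dots> < real p powr (1 - 1 / (real p - 1))" using p by (intro powr_less_mono) (auto simp: field_simps)
  also have "\<dots> = padic_radius p" using p False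
    by (simp add: padic_radius_def padic_q_def diff_conv_add_uminus powr_add del: add_uminus_conv_diff)
  finally show ?thesis .
qed

text \<open>The factor \<open>1 / (j + 1)\<close> comes from dividing the binomial coefficient of \<open>1 - s\<close> over \<open>j + 1\<close>
  by \<open>1 - s\<close>.\<close>

definition binser :: "(nat \<Rightarrow> 'a) \<Rightarrow> 'a \<Rightarrow> 'a" where
  "binser w s = (\<Sum>j. ((- s) gchoose j) / of_nat (Suc j) * w j)"

text \<open>The coefficient of \<open>s ^ n\<close> in the \<open>j\<close>-th term of
  \<open>binser\<close>: -s over j is (-1)^j / j! times the rising factorial of s, whose
  coefficients are the unsigned Stirling numbers of the first kind. Being integers, these have
  absolute value at most 1.\<close>

definition binser_coeff :: "(nat \<Rightarrow> 'a) \<Rightarrow> nat \<Rightarrow> nat \<Rightarrow> 'a" where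
  "binser_coeff w j n = (- 1) ^ j * of_nat (stirling j n) * (1 / fact (Suc j)) * w j"

lemma binser_term_eq:
  "((- s) gchoose j) / of_nat (Suc j) * w j = (\<Sum>n\<le>j. binser_coeff w j n * s ^ n)"
  unfolding gbinomial_pochhammer binser_coeff_def minus_minus stirling_pochhammer[symmetric] fact_Suc
  by (simp add: sum_distrib_left sum_distrib_right sum_divide_distrib mult_ac)

section \<open>Convergence and analyticity of binomial series\<close>

context
  fixes w :: "nat \<Rightarrow> 'a" and C :: real
  assumes w: "\<And>j. pabs (w j) \<le> C / real (padic_q p) ^ j"
begin

text \<open>The bounds for \<open>1 / fact (Suc j)\<close> and for \<open>w j\<close> multiply to
  \<open>C / padic_radius p ^ j\<close>. The maximum with 1 makes the estimate independent of
  \<open>n\<close>, which is at most \<open>j\<close> whenever the coefficient is nonzero.\<close>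

lemma binser_coeff_le:
  assumes "pabs s < padic_radius p"
  shows "pabs (binser_coeff w j n * s ^ n) \<le> C * (max 1 (pabs s) / padic_radius p) ^ j"
proof -
  have q: "real (padic_q p) > 0" using padic_q_pos by simp
  have C: "C \<ge> 0" using w[of 0] order_trans[OF zero_le_dist] by fastforce
  have R: "padic_radius p > 0" using padic_radius_gt_1 by simp
  have k: "real p powr (1 / (real p - 1)) / real (padic_q p) = 1 / padic_radius p"
    using padic_radius_eq R q by (simp add: field_simps)
  have b: "pabs (binser_coeff w j n) \<le> C / padic_radius p ^ j"
  proof -
    have "pabs (binser_coeff w j n) \<le>
        1 ^ j * 1 * (real p powr (1 / (real p - 1))) ^ j * (C / real (padic_q p) ^ j)"
      unfolding binser_coeff_def pabs_mult pabs_power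
      by (intro mult_mono pabs_of_nat pabs_inverse_fact_Suc w) (auto simp: pabs_minus pabs_one C)
    also have "\<dots> = C * (real p powr (1 / (real p - 1)) / real (padic_q p)) ^ j"
      by (simp add: power_divide)
    finally show ?thesis by (simp add: k power_divide)
  qed
  show ?thesis
  proof (cases "n \<le> j")
    case True
    have "pabs (binser_coeff w j n * s ^ n) \<le> (C / padic_radius p ^ j) * max 1 (pabs s) ^ j"
      unfolding pabs_mult pabs_power
    proof (intro mult_mono b)
      have "pabs s ^ n \<le> max 1 (pabs s) ^ n" by (intro power_mono) auto
      also have "\<dots> \<le> max 1 (pabs s) ^ j" using True by (intro power_increasing) auto
      finally show "pabs s ^ n \<le> max 1 (pabs s) ^ j" .
    qed (use C R in auto)
    then show ?thesis by (simp add: power_divide)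
  next
    case False
    then show ?thesis using C R by (simp add: binser_coeff_def)
  qed
qed

lemma binser_bound_tendsto:
  assumes "pabs (s::'a) < padic_radius p"
  shows "(\<lambda>j. C * (max 1 (pabs s) / padic_radius p) ^ j) \<longlonglongrightarrow> 0"
    and "C * (max 1 (pabs s) / padic_radius p) ^ j \<le> C"
proof -
  have C: "C \<ge> 0" using w[of 0] order_trans[OF zero_le_dist] by fastforce
  have r: "max 1 (pabs s) / padic_radius p < 1" "max 1 (pabs s) / padic_radius p \<ge> 0"
    using assms padic_radius_gt_1 by auto
  have "(\<lambda>j. C * (max 1 (pabs s) / padic_radius p) ^ j) \<longlonglongrightarrow> C * 0"
    using r by (intro tendsto_mult tendsto_const LIMSEQ_realpow_zero) auto
  then show "(\<lambda>j. C * (max 1 (pabs s) / padic_radius p) ^ j) \<longlonglongrightarrow> 0" by simp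
  show "C * (max 1 (pabs s) / padic_radius p) ^ j \<le> C"
    using r C by (intro mult_left_le power_le_one) auto
qed

lemma binser_term_le:
  assumes "pabs s < padic_radius p"
  shows "pabs (((- s) gchoose j) / of_nat (Suc j) * w j) \<le> C * (max 1 (pabs s) / padic_radius p) ^ j"
proof -
  have "C \<ge> 0" using w[of 0] order_trans[OF zero_le_dist] by fastforce
  then show ?thesis unfolding binser_term_eq using padic_radius_gt_1
    by (intro pabs_sum_le binser_coeff_le assms mult_nonneg_nonneg zero_le_power) auto
qed

lemma binser_sums:
  assumes "pabs s < padic_radius p"
  shows "(\<lambda>j. ((- s) gchoose j) / of_nat (Suc j) * w j) sums binser w s"
  unfolding binser_def
proof (intro summable_sums summable_padic)
  show "(\<lambda>j. pabs (((- s) gchoose j) / of_nat (Suc j) * w j)) \<longlonglongrightarrow> 0"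
    by (rule tendsto_sandwich[OF _ _ tendsto_const binser_bound_tendsto(1)[OF assms]])
      (intro always_eventually allI binser_term_le assms zero_le_dist)+
qed

lemma binser_le: "pabs s < padic_radius p \<Longrightarrow> pabs (binser w s) \<le> C"
  by (rule sums_le_padic[OF binser_sums order_trans[OF binser_term_le binser_bound_tendsto(2)]])

text \<open>Collecting powers of \<open>s\<close> interchanges two sums. The coefficients vanish for
  \<open>n > j\<close>, so \<open>n \<ge> N\<close> leaves only the rows \<open>j \<ge> N\<close>,
  where the bound in \<open>j\<close> is small; this is the uniformity that
  \<open>sums_swap_padic\<close> asks for.\<close>

lemma binser_analytic: "analytic_on_disc (padic_radius p) (binser w)"
  unfolding analytic_on_disc_def
proof (intro exI allI impI)
  fix s :: 'a assume s: "pabs s < padic_radius p"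
  note lim = binser_bound_tendsto(1)[OF s]
  have lim': "(\<lambda>j. pabs (binser_coeff w j n * t ^ n)) \<longlonglongrightarrow> 0"
    if "pabs t < padic_radius p" for n t
    by (rule tendsto_sandwich[OF _ _ tendsto_const binser_bound_tendsto(1)[OF that]])
      (auto intro!: always_eventually binser_coeff_le that)
  show "(\<lambda>n. (\<Sum>j. binser_coeff w j n) * s ^ n) sums binser w s"
  proof (rule sums_swap_padic[OF _ _ binser_sums[OF s]])
    show "(\<lambda>n. binser_coeff w j n * s ^ n) sums (((- s) gchoose j) / of_nat (Suc j) * w j)" for j
      unfolding binser_term_eq by (rule sums_finite) (auto simp: binser_coeff_def)
    have "(\<lambda>j. binser_coeff w j n) sums (\<Sum>j. binser_coeff w j n)" for n
      using lim'[of 1 n] padic_radius_gt_1 by (intro summable_sums summable_padic) (simp add: pabs_one)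
    from sums_cmult_padic[OF this]
    show "(\<lambda>j. binser_coeff w j n * s ^ n) sums ((\<Sum>j. binser_coeff w j n) * s ^ n)" for n
      by (simp add: mult.commute)
    fix e :: real assume e: "e > 0"
    from order_tendstoD(2)[OF lim e] obtain N where
      N: "\<And>j. j \<ge> N \<Longrightarrow> C * (max 1 (pabs s) / padic_radius p) ^ j < e"
      by (auto simp: eventually_at_top_linorder)
    have "pabs (binser_coeff w j n * s ^ n) \<le> e" if "n \<ge> N" for j n
    proof (cases "n \<le> j")
      case True
      then show ?thesis using binser_coeff_le[OF s, of j n] N[of j] that by linarith
    qed (use e in \<open>simp add: binser_coeff_def\<close>)
    then show "\<exists>N. \<forall>j. \<forall>n\<ge>N. pabs (binser_coeff w j n * s ^ n) \<le> e" by blast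
  qed
qed

end

text \<open>At \<open>s = 1 - n\<close> the binomial coefficients are those of \<open>n - 1\<close>,
  so the series stops; the absorption identity turns \<open>n / (j + 1)\<close> times
  \<open>n - 1\<close> over \<open>j\<close> into \<open>n\<close> over
  \<open>j + 1\<close>.\<close>

lemma binser_nat:
  assumes "n \<ge> 1"
  shows "of_nat n * binser w (1 - of_nat n) = (\<Sum>j<n. of_nat (n choose Suc j) * w j)"
proof -
  obtain m where n: "n = Suc m" using assms by (cases n) auto
  have "(\<lambda>j. ((- (1 - of_nat n)) gchoose j) / of_nat (Suc j) * w j) sums
      (\<Sum>j<n. ((- (1 - of_nat n)) gchoose j) / of_nat (Suc j) * w j)"
    by (rule sums_finite) (auto simp: n simp flip: binomial_gbinomial)
  then have "binser w (1 - of_nat n) = (\<Sum>j<n. (of_nat m gchoose j) / of_nat (Suc j) * w j)"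
    unfolding binser_def by (simp add: sums_iff n)
  also have "of_nat n * \<dots> = (\<Sum>j<n. of_nat (n choose Suc j) * w j)"
    unfolding sum_distrib_left
  proof (intro sum.cong refl)
    fix j
    have "(of_nat (Suc j) * of_nat (Suc m choose Suc j) :: 'a) = of_nat (Suc m) * of_nat (m choose j)"
      by (simp only: Suc_times_binomial of_nat_mult[symmetric])
    then have "(of_nat (n choose Suc j) :: 'a) = of_nat n * of_nat (m choose j) / of_nat (Suc j)"
      unfolding n by (simp only: eq_divide_eq of_nat_neq_0) (simp add: mult.commute)
    then show "of_nat n * ((of_nat m gchoose j) / of_nat (Suc j) * w j) = of_nat (n choose Suc j) * w j"
      by (simp flip: binomial_gbinomial)
  qed
  finally show ?thesis .
qed

end

section \<open>The Teichmueller character\<close>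

context padic_field
begin

lemma pabs_padic_q: "pabs (of_nat (padic_q p) :: 'a) = 1 / real (padic_q p)"
proof (cases "p = 2")
  case True
  have "(of_nat 4 :: 'a) = of_nat p ^ 2" by (simp add: True)
  then have "pabs (of_nat 4 :: 'a) = 1 / 4"
    unfolding True by (simp only: pabs_power pabs_p[unfolded True]) (simp add: power2_eq_square)
  then show ?thesis using True by (simp add: padic_q_def)
qed (simp add: padic_q_def pabs_p)

lemma pabs_power_diff_le:
  assumes "pabs (x::'a) \<le> 1" "pabs y \<le> 1"
  shows "pabs (x ^ n - y ^ n) \<le> pabs (x - y)"
  unfolding power_diff_sumr2 pabs_mult using assms
  by (intro mult_left_le pabs_sum_le) (auto simp: pabs_mult pabs_power intro!: mult_le_one power_le_one)

text \<open>Raising to the \<open>p\<close>-th power contracts: for \<open>x\<close> and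
  \<open>y\<close> congruent modulo \<open>p\<close>, the cofactor of \<open>x - y\<close> in
  \<open>x ^ p - y ^ p\<close> is congruent to \<open>p * y ^ (p - 1)\<close>, hence of size at most
  \<open>1 / p\<close>.\<close>

lemma pabs_power_p_diff_le:
  assumes "pabs (x::'a) \<le> 1" "pabs y \<le> 1" "pabs (x - y) \<le> 1 / real p"
  shows "pabs (x ^ p - y ^ p) \<le> pabs (x - y) / real p"
proof -
  have split: "(\<Sum>i<p. y ^ (p - Suc i) * x ^ i) =
      (\<Sum>i<p. y ^ (p - Suc i) * (x ^ i - y ^ i)) + of_nat p * y ^ (p - 1)"
  proof -
    have "(\<Sum>i<p. y ^ (p - Suc i) * y ^ i) = (\<Sum>i<p. y ^ (p - 1))"
      by (intro sum.cong refl) (simp flip: power_add)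
    then show ?thesis by (simp add: right_diff_distrib sum_subtractf)
  qed
  have "pabs (\<Sum>i<p. y ^ (p - Suc i) * (x ^ i - y ^ i)) \<le> 1 / real p"
  proof (intro pabs_sum_le)
    fix i
    have "pabs (y ^ (p - Suc i)) * pabs (x ^ i - y ^ i) \<le> 1 * (1 / real p)"
      using assms by (intro mult_mono order_trans[OF pabs_power_diff_le])
        (auto simp: pabs_power intro!: power_le_one)
    then show "pabs (y ^ (p - Suc i) * (x ^ i - y ^ i)) \<le> 1 / real p" by (simp add: pabs_mult)
  qed simp
  moreover have "pabs (of_nat p * y ^ (p - 1)) \<le> 1 / real p"
    using assms by (auto simp: pabs_mult pabs_p pabs_power intro!: divide_right_mono power_le_one)
  ultimately have "pabs (\<Sum>i<p. y ^ (p - Suc i) * x ^ i) \<le> 1 / real p"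
    unfolding split by (intro order_trans[OF pabs_add] max.boundedI)
  then show ?thesis unfolding power_diff_sumr2 pabs_mult
    using mult_left_mono[of _ "1 / real p" "pabs (x - y)"] by simp
qed

text \<open>If \<open>z \<noteq> 1\<close>, the sum of the powers \<open>z ^ i\<close> with
  \<open>i < m\<close> is 0; but it is close to \<open>m\<close>, which has absolute value
  1.\<close>

lemma root_of_unity_eq_1:
  assumes z: "pabs (z - 1 :: 'a) < 1" "z ^ m = 1" "\<not> p dvd m"
  shows "z = 1"
proof (rule ccontr)
  assume "z \<noteq> 1"
  moreover have "(z - 1) * (\<Sum>i<m. z ^ i) = 0" using z(2) power_diff_1_eq[of z m] by simp
  ultimately have 0: "(\<Sum>i<m. z ^ i) = 0" by simp
  have z1: "pabs z \<le> 1" using pabs_add[of "z - 1" 1] z(1) by (simp add: pabs_one)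
  have "(of_nat m :: 'a) = - (\<Sum>i<m. z ^ i - 1 ^ i)" by (simp add: sum_subtractf 0)
  then have "pabs (of_nat m :: 'a) = pabs (\<Sum>i<m. z ^ i - 1 ^ i)" by (simp only: pabs_minus)
  also have "\<dots> \<le> pabs (z - 1)"
    by (intro pabs_sum_le pabs_power_diff_le z1) (auto simp: pabs_one)
  finally show False using z by (simp add: pabs_of_nat_coprime)
qed

definition teich_exp :: nat where
  "teich_exp = (if p = 2 then 2 else p - 1)"

lemma teich_exp_pos: "teich_exp > 0"
  using prime_gt_1_nat[OF prime_p] by (simp add: teich_exp_def)

lemma root_of_unity_pabs: "n > 0 \<Longrightarrow> (x::'a) ^ n = 1 \<Longrightarrow> pabs x = 1"
  using pabs_power[of x n] by (intro power_eq_imp_eq_base[of _ n 1]) (auto simp: pabs_one)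

text \<open>For odd \<open>p\<close> the quotient of the two roots is a root of unity of order prime
  to \<open>p\<close> and close to 1. For \<open>p = 2\<close> the candidates 1 and -1 have distance
  1/2, which exceeds 1/4.\<close>

lemma teich_unique_aux:
  assumes "(x::'a) ^ teich_exp = 1" "y ^ teich_exp = 1" "pabs (x - y) \<le> 1 / real (padic_q p)"
  shows "x = y"
proof (cases "p = 2")
  case True
  then have "teich_exp = 2" unfolding teich_exp_def by simp
  then have "x\<^sup>2 = 1\<^sup>2" "y\<^sup>2 = 1\<^sup>2" using assms by simp_all
  then have xy: "x = 1 \<or> x = -1" "y = 1 \<or> y = -1" by (simp_all only: power2_eq_iff)
  have "pabs (2::'a) = 1 / 2" using pabs_p True by simp
  then have "pabs (x - y) = 1 / 2" if "x \<noteq> y"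
    using xy that pabs_minus[of 2] by auto
  then show ?thesis using assms(3) True by (auto simp: padic_q_def)
next
  case False
  have p: "p > 1" using prime_gt_1_nat[OF prime_p] .
  have y: "pabs y = 1" "y \<noteq> 0"
    using root_of_unity_pabs[OF teich_exp_pos assms(2)] by auto
  have "x / y - 1 = (x - y) / y" using y by (simp add: field_simps)
  then have "pabs (x / y - 1) \<le> 1 / real p" using assms(3) False y
    by (simp add: pabs_divide padic_q_def)
  also have "1 / real p < 1" using p by simp
  finally have "pabs (x / y - 1) < 1" .
  moreover have "(x / y) ^ teich_exp = 1" using assms by (simp add: power_divide)
  moreover have "\<not> p dvd teich_exp" using p False by (auto simp: teich_exp_def dest: dvd_imp_le)
  ultimately have "x / y = 1" by (rule root_of_unity_eq_1)
  then show ?thesis using y by simp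
qed

lemma of_int_in_closure_Ints: "of_int a \<in> closure (\<int> :: 'a set)"
  using closure_subset[of "\<int> :: 'a set"] by auto

text \<open>For odd \<open>p\<close> the root is the limit of \<open>a ^ (p ^ n)\<close>: Fermat's
  theorem makes the first difference divisible by \<open>p\<close>, and each further
  \<open>p\<close>-th power gains a factor \<open>p\<close>. For \<open>p = 2\<close> it is the sign
  congruent to \<open>a\<close> modulo 4.\<close>

lemma teich_exists:
  assumes a: "\<not> int p dvd a"
  shows "\<exists>x::'a. x \<in> closure \<int> \<and> x ^ teich_exp = 1 \<and> pabs (x - of_int a) \<le> 1 / real (padic_q p)"
proof (cases "p = 2")
  case True
  have *: "pabs (of_int (b - a) :: 'a) \<le> 1 / real (padic_q p)" if "4 dvd b - a" for b
    using pabs_of_int_dvd[of "padic_q p" "b - a"] that True pabs_padic_q by (simp add: padic_q_def)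
  have e: "teich_exp = 2" unfolding teich_exp_def using True by simp
  have "4 dvd 1 - a \<or> 4 dvd - 1 - a" using a True by simp presburger
  then show ?thesis
  proof
    assume "4 dvd 1 - a"
    then show ?thesis using *[of 1] of_int_in_closure_Ints[of 1] by (intro exI[of _ 1]) simp
  next
    assume "4 dvd - 1 - a"
    then show ?thesis using *[of "-1"] of_int_in_closure_Ints[of "-1"]
      by (intro exI[of _ "-1"]) (simp add: e)
  qed
next
  case False
  have p: "p > 1" using prime_gt_1_nat[OF prime_p] .
  define X :: "nat \<Rightarrow> 'a" where "X = (\<lambda>n. of_int a ^ (p ^ n))"
  have X1: "pabs (X n) \<le> 1" for n unfolding X_def pabs_power by (intro power_le_one pabs_of_int) auto
  have X_Suc: "X (Suc n) = X n ^ p" for n by (simp add: X_def mult.commute flip: power_mult)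
  have "[a ^ p = a] (mod int p)"
  proof -
    have "[a ^ (p - 1) = 1] (mod int p)"
    proof -
      have "[nat (a mod int p) ^ (p - 1) = 1] (mod p)"
      proof (intro fermat_theorem prime_p notI)
        assume "p dvd nat (a mod int p)"
        then have "int p dvd int (nat (a mod int p))" by (simp only: int_dvd_int_iff)
        then show False using a p by (simp add: dvd_mod_iff)
      qed
      then have "[int (nat (a mod int p) ^ (p - 1)) = int 1] (mod int p)" by (simp only: cong_int_iff)
      then have "[(a mod int p) ^ (p - 1) = 1] (mod int p)" using p by simp
      then show ?thesis by (simp add: cong_def power_mod)
    qed
    then have "[a ^ (p - 1) * a = 1 * a] (mod int p)" by (rule cong_mult) simp
    then show ?thesis using p by (simp add: power_eq_if mult.commute)
  qed
  then have "int p dvd a ^ p - a" by (simp add: cong_iff_dvd_diff)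
  from pabs_of_int_dvd[OF this] have 0: "pabs (X 1 - X 0) \<le> 1 / real p" by (simp add: X_def pabs_p)
  have step: "pabs (X (Suc n) - X n) \<le> (1 / real p) ^ Suc n" for n
  proof (induction n)
    case (Suc n)
    have "(1 / real p) ^ Suc n \<le> (1 / real p) ^ 1" using p by (intro power_decreasing) auto
    then have "pabs (X (Suc (Suc n)) - X (Suc n)) \<le> pabs (X (Suc n) - X n) / real p"
      unfolding X_Suc[of "Suc n"] X_Suc[of n, symmetric] using Suc
      by (subst (2) X_Suc) (intro pabs_power_p_diff_le X1, simp)
    also have "\<dots> \<le> (1 / real p) ^ Suc n / real p" using Suc by (intro divide_right_mono) auto
    finally show ?case by simp
  qed (use 0 in simp)
  have "(\<lambda>n. (1 / real p) ^ Suc n) \<longlonglongrightarrow> 0" using p by (intro LIMSEQ_Suc LIMSEQ_realpow_zero) auto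
  then have "(\<lambda>n. pabs (X (Suc n) - X n)) \<longlonglongrightarrow> 0"
    by (rule tendsto_sandwich[OF _ _ tendsto_const, rotated 2]) (intro always_eventually allI step zero_le_dist)+
  then obtain D where D: "(\<lambda>n. X (Suc n) - X n) sums D"
    using summable_padic summable_def by blast
  define L where "L = D + X 0"
  have "pabs D \<le> 1 / real p"
  proof (rule sums_le_padic[OF D])
    show "pabs (X (Suc n) - X n) \<le> 1 / real p" for n
      using order_trans[OF step[of n] power_decreasing[of 1 "Suc n" "1 / real p"]] p by simp
  qed
  then have La: "pabs (L - of_int a) \<le> 1 / real (padic_q p)" using False by (simp add: L_def X_def padic_q_def)
  have "(\<lambda>n. (\<Sum>i<n. X (Suc i) - X i) + X 0) \<longlonglongrightarrow> L"
    unfolding L_def using D by (intro tendsto_add_padic tendsto_const) (simp add: sums_def)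
  then have lim: "X \<longlonglongrightarrow> L" by (simp add: sum_lessThan_telescope)
  have L1: "pabs L \<le> 1" using tendsto_pabs_le[OF lim, of 0 1] X1 by simp
  have "L ^ p = L"
  proof -
    have "(\<lambda>n. X (Suc n)) \<longlonglongrightarrow> L ^ p"
      unfolding tendsto_pabs_iff
    proof (rule tendsto_sandwich[OF _ _ tendsto_const lim[unfolded tendsto_pabs_iff]])
      show "\<forall>\<^sub>F n in sequentially. pabs (X (Suc n) - L ^ p) \<le> pabs (X n - L)"
        unfolding X_Suc by (intro always_eventually allI pabs_power_diff_le X1 L1)
    qed auto
    then show ?thesis using LIMSEQ_Suc[OF lim] LIMSEQ_unique by blast
  qed
  moreover have "L \<noteq> 0"
  proof
    assume "L = 0"
    then have "1 \<le> 1 / real p" using La False pabs_of_int_coprime[OF a] by (simp add: pabs_minus padic_q_def)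
    then show False using p by simp
  qed
  ultimately have "L ^ (p - 1) = 1" using p by (simp add: power_eq_if)
  moreover have "L \<in> closure \<int>" unfolding closure_sequential using lim
    by (intro exI[of _ X]) (auto simp: X_def)
  ultimately show ?thesis using La False by (intro exI[of _ L]) (simp add: teich_exp_def)
qed

lemma
  assumes "\<not> int p dvd a"
  shows teich_power: "(teich p a :: 'a) ^ teich_exp = 1"
    and pabs_teich_diff: "pabs (teich p a - of_int a :: 'a) \<le> 1 / real (padic_q p)"
proof -
  define P where "P = (\<lambda>x::'a. x \<in> closure \<int> \<and> x ^ teich_exp = 1 \<and> pabs (x - of_int a) \<le> 1 / real (padic_q p))"
  have t: "teich p a = (THE x. P x)"
    using assms by (simp add: teich_def P_def teich_exp_def pabs_padic_q)
  obtain x where x: "P x" using teich_exists[OF assms] unfolding P_def by blast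
  have "y = x" if "P y" for y
  proof (rule teich_unique_aux)
    have "pabs ((y - of_int a) - (x - of_int a)) \<le> 1 / real (padic_q p)"
      using x that by (intro order_trans[OF pabs_diff[of "y - of_int a"]] max.boundedI) (auto simp: P_def)
    then show "pabs (y - x) \<le> 1 / real (padic_q p)" by simp
  qed (use x that in \<open>auto simp: P_def\<close>)
  then have "P (teich p a)" unfolding t using x by (rule theI[rotated])
  then show "(teich p a :: 'a) ^ teich_exp = 1" "pabs (teich p a - of_int a :: 'a) \<le> 1 / real (padic_q p)"
    by (auto simp: P_def)
qed

lemma teich_eqI:
  assumes "\<not> int p dvd a" "(x::'a) ^ teich_exp = 1" "pabs (x - of_int a) \<le> 1 / real (padic_q p)"
  shows "teich p a = x"
proof (rule teich_unique_aux)
  have "pabs ((teich p a - of_int a) - (x - of_int a)) \<le> 1 / real (padic_q p)"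
    using assms(3) pabs_teich_diff[OF assms(1)] by (intro order_trans[OF pabs_diff[of "teich p a - of_int a"]] max.boundedI)
  then show "pabs (teich p a - x) \<le> 1 / real (padic_q p)" by simp
qed (use assms teich_power in auto)

lemma pabs_teich: "\<not> int p dvd a \<Longrightarrow> pabs (teich p a :: 'a) = 1"
  using root_of_unity_pabs[OF teich_exp_pos teich_power] .

lemma p_dvd_mult: "int p dvd a * b \<longleftrightarrow> int p dvd a \<or> int p dvd b"
  using prime_p by (simp add: prime_dvd_mult_iff)

lemma teich_mult: "(teich p (a * b) :: 'a) = teich p a * teich p b"
proof (cases "int p dvd a * b")
  case True
  then show ?thesis by (auto simp: teich_def p_dvd_mult)
next
  case False
  then have ab: "\<not> int p dvd a" "\<not> int p dvd b" by (auto simp: p_dvd_mult)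
  show ?thesis
  proof (rule teich_eqI[OF False])
    show "(teich p a * teich p b :: 'a) ^ teich_exp = 1"
      using ab by (simp add: power_mult_distrib teich_power)
    have "pabs (teich p a * (teich p b - of_int b) + (teich p a - of_int a) * of_int b :: 'a)
        \<le> 1 / real (padic_q p)"
      using ab by (intro order_trans[OF pabs_add] max.boundedI)
        (simp_all add: pabs_mult pabs_teich pabs_of_int_coprime pabs_teich_diff)
    then show "pabs (teich p a * teich p b - of_int (a * b) :: 'a) \<le> 1 / real (padic_q p)"
      by (simp add: algebra_simps)
  qed
qed

lemma p_dvd_padic_q: "p dvd padic_q p"
  by (simp add: padic_q_def)

lemma teich_cong:
  assumes "[a = b] (mod int (padic_q p))"
  shows "(teich p a :: 'a) = teich p b"
proof -
  have "[a = b] (mod int p)"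
    using assms p_dvd_padic_q by (meson cong_dvd_modulus int_dvd_int_iff)
  then have iff: "int p dvd a \<longleftrightarrow> int p dvd b" by (rule cong_dvd_iff)
  show ?thesis
  proof (cases "int p dvd a")
    case True
    then show ?thesis using iff by (simp add: teich_def)
  next
    case False
    have "int (padic_q p) dvd b - a" using assms by (simp add: cong_iff_dvd_diff dvd_diff_commute)
    from pabs_of_int_dvd[OF this] have d: "pabs (of_int (b - a) :: 'a) \<le> 1 / real (padic_q p)"
      by (simp add: pabs_padic_q)
    have "pabs ((teich p b - of_int b) + of_int (b - a) :: 'a) \<le> 1 / real (padic_q p)"
      using False iff d by (intro order_trans[OF pabs_add] max.boundedI pabs_teich_diff) auto
    then show ?thesis using False iff by (intro teich_eqI teich_power) auto
  qed
qed

lemma coprime_padic_q: "coprime a (int (padic_q p)) \<longleftrightarrow> \<not> int p dvd a"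
proof -
  have "coprime a (int p) \<longleftrightarrow> \<not> int p dvd a"
    using prime_imp_coprime[of "int p" a] prime_p not_prime_unit[of "int p"]
    by (auto simp: coprime_commute dest: coprime_common_divisor[of "int p" a "int p"])
  moreover have "coprime a 4 \<longleftrightarrow> coprime a (2::int)"
    using coprime_power_right_iff[of a "2::int" 2] by simp
  ultimately show ?thesis by (auto simp: padic_q_def)
qed

lemma dirichlet_char_teich: "dirichlet_char (padic_q p) (teich p :: int \<Rightarrow> 'a)"
proof -
  have "(teich p a :: 'a) \<noteq> 0 \<longleftrightarrow> \<not> int p dvd a" for a
    using pabs_teich[of a] by (auto simp: teich_def)
  then show ?thesis using teich_cong teich_mult padic_q_pos
    by (auto simp: dirichlet_char_def coprime_padic_q)
qed

section \<open>The powers of \<open>diamond\<close>\<close>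

lemma pabs_diamond_minus_1:
  assumes "\<not> int p dvd a"
  shows "pabs (diamond p a - 1 :: 'a) \<le> 1 / real (padic_q p)"
proof -
  have t: "pabs (teich p a :: 'a) = 1" using pabs_teich[OF assms] .
  then have "(teich p a :: 'a) \<noteq> 0" by auto
  then have "diamond p a - 1 = (of_int a - teich p a) / (teich p a :: 'a)"
    by (simp add: diamond_def diff_divide_distrib)
  then show ?thesis using pabs_teich_diff[OF assms]
    by (simp add: pabs_divide t pabs_diff_commute[of "of_int a"])
qed

lemma pabs_diamond: "\<not> int p dvd a \<Longrightarrow> pabs (diamond p a :: 'a) = 1"
  by (simp add: diamond_def pabs_divide pabs_teich pabs_of_int_coprime)

lemma pabs_diamond_power_le:
  assumes "\<not> int p dvd a"
  shows "pabs ((diamond p a - 1 :: 'a) ^ j) \<le> 1 / real (padic_q p) ^ j"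
  using power_mono[OF pabs_diamond_minus_1[OF assms], of j] by (simp add: pabs_power power_divide)

lemma pabs_diamond_power_Suc_le:
  assumes "\<not> int p dvd a"
  shows "pabs ((diamond p a - 1 :: 'a) ^ Suc j) \<le> 1 / real (padic_q p) ^ j"
proof (rule order_trans[OF pabs_diamond_power_le[OF assms]])
  show "1 / real (padic_q p) ^ Suc j \<le> 1 / real (padic_q p) ^ j"
    using padic_q_pos by (intro divide_left_mono power_increasing) auto
qed

text \<open>The factor \<open>Suc j\<close> cancels the division built into
  \<open>binser\<close>.\<close>

lemma diamond_pow_minus:
  "diamond_pow p a (- s :: 'a) = binser (\<lambda>j. of_nat (Suc j) * (diamond p a - 1) ^ j) s"
  by (simp add: diamond_pow_def binser_def del: of_nat_Suc)

lemma one_minus_gchoose_Suc: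
  "(1 - s :: 'a) gchoose Suc j = (1 - s) * ((- s gchoose j) / of_nat (Suc j))"
  using gbinomial_absorption[of j "1 - s"] by (simp add: eq_divide_eq mult.commute del: of_nat_Suc)

text \<open>Apart from the term \<open>j = 0\<close>, every term is divisible by
  \<open>1 - s\<close>. This later isolates the pole of the L-function.\<close>

lemma diamond_pow_one_minus:
  assumes "\<not> int p dvd a" "pabs (s::'a) < padic_radius p"
  shows "diamond_pow p a (1 - s) = 1 + (1 - s) * binser (\<lambda>j. (diamond p a - 1) ^ Suc j) s"
proof -
  note binser_sums[OF pabs_diamond_power_Suc_le[OF assms(1)] assms(2)]
  from sums_cmult_padic[OF this, of "1 - s"]
  have "(\<lambda>j. (1 - s gchoose Suc j) * (diamond p a - 1) ^ Suc j) sums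
      ((1 - s) * binser (\<lambda>j. (diamond p a - 1) ^ Suc j) s)"
    by (simp only: one_minus_gchoose_Suc times_divide_eq_left times_divide_eq_right mult.assoc)
  then show ?thesis
    using sums_head_padic[of "\<lambda>j. (1 - s gchoose j) * (diamond p a - 1) ^ j" 1]
    by (simp add: diamond_pow_def sums_iff)
qed

lemma diamond_pow_of_nat: "diamond_pow p a (of_nat n :: 'a) = diamond p a ^ n"
proof -
  have "(\<lambda>j. (of_nat n gchoose j) * (diamond p a - 1 :: 'a) ^ j) sums
      (\<Sum>j\<le>n. (of_nat n gchoose j) * (diamond p a - 1) ^ j)"
    by (rule sums_finite) (auto simp flip: binomial_gbinomial)
  moreover have "(\<Sum>j\<le>n. (of_nat n gchoose j) * (diamond p a - 1 :: 'a) ^ j) = diamond p a ^ n"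
    using binomial_ring[of "diamond p a - 1 :: 'a" 1 n] by (simp flip: binomial_gbinomial)
  ultimately show ?thesis by (simp add: diamond_pow_def sums_iff)
qed

lemma
  assumes "\<not> int p dvd a"
  shows analytic_diamond_pow_minus: "analytic_on_disc (padic_radius p) (\<lambda>s::'a. diamond_pow p a (- s))"
    and pabs_diamond_pow_minus: "pabs (s::'a) < padic_radius p \<Longrightarrow> pabs (diamond_pow p a (- s)) \<le> 1"
proof -
  have "pabs (of_nat (Suc j) * (diamond p a - 1 :: 'a) ^ j) \<le> 1 / real (padic_q p) ^ j" for j
    using mult_mono[OF pabs_of_nat[of "Suc j"] pabs_diamond_power_le[OF assms, of j]]
    by (simp add: pabs_mult del: of_nat_Suc)
  from binser_analytic[OF this] binser_le[OF this]
  show "analytic_on_disc (padic_radius p) (\<lambda>s::'a. diamond_pow p a (- s))"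
    "pabs (s::'a) < padic_radius p \<Longrightarrow> pabs (diamond_pow p a (- s)) \<le> 1"
    unfolding diamond_pow_minus by auto
qed

text \<open>The exponent law is obtained by comparing analytic functions: at
  \<open>s = 1 - n\<close> both sides are the \<open>n\<close>-th power of
  \<open>diamond p a\<close>.\<close>

lemma diamond_pow_shift:
  assumes a: "\<not> int p dvd a" and s: "pabs (s::'a) < padic_radius p"
  shows "diamond_pow p a (1 - s) = diamond p a * diamond_pow p a (- s)"
proof -
  define g where "g = (\<lambda>s. 1 + (1 - s) * binser (\<lambda>j. (diamond p a - 1) ^ Suc j) s :: 'a)"
  have g: "diamond_pow p a (1 - t) = g t" if "pabs t < padic_radius p" for t
    using diamond_pow_one_minus[OF a that] by (simp add: g_def)
  have "analytic_on_disc (padic_radius p) g"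
    unfolding g_def
    by (intro analytic_add analytic_mult analytic_diff analytic_const analytic_ident
        binser_analytic[OF pabs_diamond_power_Suc_le[OF a]])
  moreover have "analytic_on_disc (padic_radius p) (\<lambda>s. diamond p a * diamond_pow p a (- s) :: 'a)"
    by (intro analytic_cmult analytic_diamond_pow_minus a)
  ultimately have "g s = diamond p a * diamond_pow p a (- s)"
  proof (rule analytic_eqI[OF _ _ padic_radius_gt_1 _ s])
    fix n :: nat assume n: "n \<ge> 1"
    have "pabs (1 - of_nat n :: 'a) \<le> 1"
      using pabs_of_int[of "1 - int n"] by simp
    then have *: "pabs (1 - of_nat n :: 'a) < padic_radius p" using padic_radius_gt_1 by linarith
    have "g (1 - of_nat n) = diamond p a ^ n"
      using g[OF *] diamond_pow_of_nat[of a n] by simp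
    moreover have "- (1 - of_nat n) = (of_nat (n - 1) :: 'a)" using n by simp
    ultimately show "g (1 - of_nat n) = diamond p a * diamond_pow p a (- (1 - of_nat n))"
      using n by (simp only: diamond_pow_of_nat) (simp flip: power_Suc)
  qed
  then show ?thesis using g[OF s] by simp
qed

lemma analytic_diamond_pow_one_minus:
  "\<not> int p dvd a \<Longrightarrow> analytic_on_disc (padic_radius p) (\<lambda>s::'a. diamond_pow p a (1 - s))"
  by (rule analytic_cong[OF analytic_cmult[OF analytic_diamond_pow_minus]])
    (simp_all add: diamond_pow_shift)

lemma pabs_diamond_pow_one_minus:
  "\<not> int p dvd a \<Longrightarrow> pabs (s::'a) < padic_radius p \<Longrightarrow> pabs (diamond_pow p a (1 - s)) \<le> 1"
  by (simp add: diamond_pow_shift pabs_mult pabs_diamond pabs_diamond_pow_minus)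

end

section \<open>Dirichlet characters and conductors\<close>

text \<open>Characters of different moduli can be compared only at arguments prime to both. The
  factor \<open>t\<close> collects the primes of \<open>M\<close> not dividing \<open>a\<close>.
  Then each prime of \<open>M\<close> divides exactly one of \<open>a\<close> and
  \<open>m * t\<close>, because the primes dividing \<open>a\<close> do not divide
  \<open>m\<close>.\<close>

lemma coprime_lift:
  fixes a :: int
  assumes "coprime a m" "M \<noteq> 0"
  obtains b where "[b = a] (mod m)" "coprime b (m * M)"
proof -
  define t where "t = \<Prod>{l \<in> prime_factors M. \<not> l dvd a}"
  have fin: "finite {l \<in> prime_factors M. \<not> l dvd a}" by simp
  have "coprime (a + m * t) M"
  proof (rule ccontr)
    assume "\<not> coprime (a + m * t) M"
    then have "\<not> is_unit (gcd (a + m * t) M)" by (simp add: coprime_iff_gcd_eq_1)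
    moreover have "gcd (a + m * t) M \<noteq> 0" using assms by simp
    ultimately obtain l where l: "prime l" "l dvd a + m * t" "l dvd M"
      using prime_divisor_exists[of "gcd (a + m * t) M"] by auto
    show False
    proof (cases "l dvd a")
      case True
      then have "l dvd m * t" using l(2) dvd_add_right_iff by blast
      moreover have "\<not> l dvd m" using True l(1) assms(1) by (metis coprime_common_divisor not_prime_unit)
      ultimately have "l dvd t" using l(1) by (simp add: prime_dvd_mult_iff)
      then obtain l' where l': "l' \<in> prime_factors M" "\<not> l' dvd a" "l dvd l'"
        using l(1) fin unfolding t_def by (subst (asm) prime_dvd_prod_iff) auto
      then have "l = l'" using l(1) by (auto intro: primes_dvd_imp_eq)
      then show False using l' True by simp
    next
      case False
      then have "l dvd t" using l assms fin unfolding t_def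
        by (intro dvd_prodI) (auto simp: in_prime_factors_iff)
      then show False using False l(2) dvd_add_left_iff by (metis dvd_mult)
    qed
  qed
  moreover have "coprime (a + m * t) m" using assms(1) coprime_iff_gcd_eq_1
    by (metis gcd.commute gcd_add_mult mult.commute add.commute)
  ultimately show ?thesis using that[of "a + m * t"]
    by (simp add: cong_iff_dvd_diff)
qed

context
  fixes chi :: "int \<Rightarrow> 'a::field" and m :: nat
  assumes chi: "dirichlet_char m chi"
begin

lemma dirichlet_char_pos: "m > 0"
  and dirichlet_char_cong: "[a = b] (mod int m) \<Longrightarrow> chi a = chi b"
  and dirichlet_char_mult: "chi (a * b) = chi a * chi b"
  and dirichlet_char_eq_0_iff: "chi a \<noteq> 0 \<longleftrightarrow> coprime a (int m)"
  using chi by (auto simp: dirichlet_char_def)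

lemma dirichlet_char_1: "chi 1 = 1"
  using dirichlet_char_mult[of 1 1] dirichlet_char_eq_0_iff[of 1] by simp

end

text \<open>By the Chinese remainder theorem, a value which depends only on the residue modulo \<open>m1\<close> and only
  on the residue modulo \<open>m2\<close> depends only on the residue modulo the greatest common divisor.\<close>

lemma dirichlet_char_gcd:
  fixes chi psi :: "int \<Rightarrow> 'a::field"
  assumes chi: "dirichlet_char m1 chi" and psi: "dirichlet_char m2 psi"
    and agree': "\<forall>a. chi a \<noteq> 0 \<longrightarrow> psi a \<noteq> 0 \<longrightarrow> psi a = chi a"
  shows "\<exists>theta. dirichlet_char (gcd m1 m2) theta \<and>
    (\<forall>a. chi a \<noteq> 0 \<longrightarrow> theta a = chi a) \<and> (\<forall>a. psi a \<noteq> 0 \<longrightarrow> theta a = psi a)"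
proof -
  note agree = agree'[rule_format]
  define d where "d = gcd m1 m2"
  define M where "M = int m1 * int m2"
  have pos: "m1 > 0" "m2 > 0" "M \<noteq> 0" "d > 0"
    using dirichlet_char_pos[OF chi] dirichlet_char_pos[OF psi] by (auto simp: M_def d_def)
  have cop: "chi a \<noteq> 0" "psi a \<noteq> 0" if "coprime a M" for a
    using that dirichlet_char_eq_0_iff[OF chi] dirichlet_char_eq_0_iff[OF psi] by (auto simp: M_def)
  have eq: "chi a = chi b" if ab: "[a = b] (mod int d)" "coprime a M" "coprime b M" for a b
  proof -
    have "int d dvd b - a" using ab(1) by (simp add: cong_iff_dvd_diff dvd_diff_commute)
    then obtain k where k: "b - a = int d * k" by auto
    obtain u v where uv: "u * int m1 + v * int m2 = int d"
      using bezout_int[of "int m1" "int m2"] by (auto simp: d_def)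
    \<comment> \<open>\<open>c\<close> is \<open>a\<close> modulo \<open>m1\<close> and
      \<open>b\<close> modulo \<open>m2\<close>, so that
      \<open>chi a = chi c = psi c = psi b = chi b\<close>.\<close>
    define c where "c = a + k * u * int m1"
    have c1: "[c = a] (mod int m1)" by (simp add: c_def cong_iff_dvd_diff)
    have "b - c = k * v * int m2" using k by (simp add: c_def algebra_simps flip: uv)
    then have c2: "[b = c] (mod int m2)" by (simp add: cong_iff_dvd_diff)
    have "chi c = chi a" "psi b = psi c"
      using dirichlet_char_cong[OF chi c1] dirichlet_char_cong[OF psi c2] by auto
    then have "psi c \<noteq> 0" "chi c \<noteq> 0" using cop ab(2,3) by auto
    then show ?thesis using agree[of c] agree[of b] cop ab(2,3) \<open>chi c = chi a\<close> \<open>psi b = psi c\<close> by auto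
  qed
  \<comment> \<open>A representative at which both characters are nonzero; by \<open>eq\<close> the
    value of \<open>chi\<close> there does not depend on the choice.\<close>
  define lift where "lift = (\<lambda>a. SOME b. [b = a] (mod int d) \<and> coprime b M)"
  have lift: "[lift a = a] (mod int d)" "coprime (lift a) M" if "coprime a (int d)" for a
  proof -
    obtain b where "[b = a] (mod int d)" "coprime b (int d * M)"
      using coprime_lift[OF \<open>coprime a (int d)\<close> pos(3)] by blast
    then have "\<exists>b. [b = a] (mod int d) \<and> coprime b M" by auto
    then show "[lift a = a] (mod int d)" "coprime (lift a) M"
      unfolding lift_def using someI_ex[where P = "\<lambda>b. [b = a] (mod int d) \<and> coprime b M"] by auto
  qed
  define theta where "theta = (\<lambda>a. if coprime a (int d) then chi (lift a) else 0)"
  have th: "theta a = chi b" if "[b = a] (mod int d)" "coprime b M" for a b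
  proof -
    have "int d dvd M" unfolding M_def d_def by (intro dvd_mult2) simp
    then have "coprime b (int d)" by (rule coprime_divisors[OF dvd_refl _ that(2)])
    then have a: "coprime a (int d)" by (rule cong_imp_coprime[OF that(1)])
    have "[lift a = b] (mod int d)" by (rule cong_trans[OF lift(1)[OF a] cong_sym[OF that(1)]])
    then show ?thesis using a eq[OF _ lift(2)[OF a] that(2)] by (simp add: theta_def)
  qed
  have "dirichlet_char d theta"
    unfolding dirichlet_char_def
  proof (intro conjI allI impI)
    fix a b
    show "theta a \<noteq> 0 \<longleftrightarrow> coprime a (int d)" using cop(1)[OF lift(2)[of a]] by (auto simp: theta_def)
    show "theta (a * b) = theta a * theta b"
    proof (cases "coprime a (int d) \<and> coprime b (int d)")
      case True
      then have "theta (a * b) = chi (lift a * lift b)"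
        using lift[of a] lift[of b] by (intro th cong_mult) auto
      then show ?thesis using True by (simp add: theta_def dirichlet_char_mult[OF chi])
    qed (auto simp: theta_def)
    assume ab: "[a = b] (mod int d)"
    show "theta a = theta b"
    proof (cases "coprime a (int d)")
      case True
      then have "theta b = chi (lift a)" using lift[OF True] by (intro th cong_trans[OF _ ab])
      then show ?thesis using True by (simp add: theta_def)
    next
      case False
      then have "\<not> coprime b (int d)" using cong_imp_coprime[OF cong_sym[OF ab]] by blast
      then show ?thesis using False by (simp add: theta_def)
    qed
  qed (use pos in simp)
  moreover have "theta a = chi a" if "chi a \<noteq> 0" for a
  proof -
    have "coprime a (int m1)" using that dirichlet_char_eq_0_iff[OF chi] by blast
    then obtain b where b: "[b = a] (mod int m1)" "coprime b (int m1 * int m2)"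
      using coprime_lift[of a "int m1" "int m2"] pos by auto
    have "[b = a] (mod int d)" using b(1) by (rule cong_dvd_modulus) (simp add: d_def)
    then have "theta a = chi b" using b by (intro th) (auto simp: M_def)
    then show ?thesis using dirichlet_char_cong[OF chi b(1)] by simp
  qed
  moreover have "theta a = psi a" if "psi a \<noteq> 0" for a
  proof -
    have "coprime a (int m2)" using that dirichlet_char_eq_0_iff[OF psi] by blast
    then obtain b where b: "[b = a] (mod int m2)" "coprime b (int m2 * int m1)"
      using coprime_lift[of a "int m2" "int m1"] pos by auto
    then have bM: "coprime b M" by (simp add: M_def mult.commute)
    have "[b = a] (mod int d)" using b(1) by (rule cong_dvd_modulus) (simp add: d_def)
    then have "theta a = chi b" using bM by (intro th) auto
    also have "\<dots> = psi b" using agree[OF cop[OF bM]] by simp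
    also have "\<dots> = psi a" using dirichlet_char_cong[OF psi b(1)] by simp
    finally show ?thesis .
  qed
  ultimately show ?thesis unfolding d_def by (intro exI[of _ theta]) simp
qed

lemma conductor_ex:
  assumes "dirichlet_char m (chi :: int \<Rightarrow> 'a::field)"
  obtains psi where "dirichlet_char (conductor chi) psi" "\<And>a. chi a \<noteq> 0 \<Longrightarrow> psi a = chi a"
proof -
  have "\<exists>g \<psi>. dirichlet_char g \<psi> \<and> (\<forall>a. chi a \<noteq> 0 \<longrightarrow> \<psi> a = chi a)" using assms by blast
  from LeastI_ex[OF this] show ?thesis using that unfolding conductor_def by blast
qed

lemma conductor_le:
  assumes "dirichlet_char g psi" "\<And>a. chi a \<noteq> 0 \<Longrightarrow> psi a = (chi a :: 'a::field)"
  shows "conductor chi \<le> g"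
  unfolding conductor_def using assms by (intro Least_le) blast

text \<open>\<open>psi\<close> need not extend \<open>chi\<close>: after a twist by a power of the Teichmueller character it vanishes at
  the multiples of \<open>p\<close> even where \<open>chi\<close> does not.\<close>

lemma conductor_dvd:
  fixes chi psi :: "int \<Rightarrow> 'a::field"
  assumes "dirichlet_char (conductor chi0) chi" "\<And>a. chi0 a \<noteq> 0 \<Longrightarrow> chi a = chi0 a"
    and "dirichlet_char m psi" "\<And>a. chi a \<noteq> 0 \<Longrightarrow> psi a \<noteq> 0 \<Longrightarrow> psi a = chi a"
  shows "conductor chi0 dvd m"
proof -
  obtain theta where th: "dirichlet_char (gcd (conductor chi0) m) theta"
    "\<forall>a. chi a \<noteq> 0 \<longrightarrow> theta a = chi a"
    using dirichlet_char_gcd[OF assms(1,3)] assms(4) by blast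
  have "conductor chi0 \<le> gcd (conductor chi0) m"
  proof (rule conductor_le[OF th(1)])
    show "theta a = chi0 a" if "chi0 a \<noteq> 0" for a
      using th(2)[rule_format, of a] assms(2)[OF that] that by simp
  qed
  moreover have "gcd (conductor chi0) m \<le> conductor chi0"
    by (rule dvd_imp_le[OF gcd_dvd1 dirichlet_char_pos[OF assms(1)]])
  ultimately have eq: "gcd (conductor chi0) m = conductor chi0" by linarith
  have "gcd (conductor chi0) m dvd m" by (rule gcd_dvd2)
  then show ?thesis unfolding eq .
qed

text \<open>The description has a unique solution: every class prime to the conductor contains an
  argument where \<open>chi\<close> is nonzero, and there all extensions equal \<open>chi\<close>.
  An extension of the primitive character also extends \<open>chi\<close>, so the conductor does not
  drop.\<close>

lemma
  fixes chi :: "int \<Rightarrow> 'a::field"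
  assumes chi: "dirichlet_char m chi"
  shows dirichlet_char_primitive: "dirichlet_char (conductor chi) (primitive_char chi)"
    and primitive_char_eq: "\<And>a. chi a \<noteq> 0 \<Longrightarrow> primitive_char chi a = chi a"
    and conductor_primitive: "conductor (primitive_char chi) = conductor chi"
proof -
  define P where "P = (\<lambda>psi. dirichlet_char (conductor chi) psi \<and> (\<forall>a. chi a \<noteq> 0 \<longrightarrow> psi a = chi a))"
  obtain psi where psi: "P psi" using conductor_ex[OF chi] unfolding P_def by blast
  have "psi' = psi" if "P psi'" for psi'
  proof
    fix a
    have "dirichlet_char (conductor chi) psi" "dirichlet_char (conductor chi) psi'"
      and ext: "\<And>b. chi b \<noteq> 0 \<Longrightarrow> psi b = chi b" "\<And>b. chi b \<noteq> 0 \<Longrightarrow> psi' b = chi b"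
      using psi that by (auto simp: P_def)
    note c = dirichlet_char_cong[OF this(1)] dirichlet_char_cong[OF this(2)]
      dirichlet_char_eq_0_iff[OF this(1)] dirichlet_char_eq_0_iff[OF this(2)]
    show "psi' a = psi a"
    proof (cases "coprime a (int (conductor chi))")
      case True
      then obtain b where b: "[b = a] (mod int (conductor chi))" "coprime b (int (conductor chi) * int m)"
        using coprime_lift[of a "int (conductor chi)" "int m"] dirichlet_char_pos[OF chi] by auto
      then have "chi b \<noteq> 0" using dirichlet_char_eq_0_iff[OF chi] by auto
      then show ?thesis using c(1)[OF b(1)] c(2)[OF b(1)] ext[of b] by simp
    next
      case False
      then show ?thesis using c(3)[of a] c(4)[of a] by simp
    qed
  qed
  then have "P (THE psi. P psi)" using theI[of P psi] psi by blast
  then have P: "P (primitive_char chi)" unfolding primitive_char_def P_def .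
  then show 1: "dirichlet_char (conductor chi) (primitive_char chi)"
    and 2: "\<And>a. chi a \<noteq> 0 \<Longrightarrow> primitive_char chi a = chi a" by (auto simp: P_def)
  show "conductor (primitive_char chi) = conductor chi"
  proof (rule antisym)
    show "conductor (primitive_char chi) \<le> conductor chi" using 1 by (intro conductor_le) auto
    obtain th where th: "dirichlet_char (conductor (primitive_char chi)) th"
      "\<And>a. primitive_char chi a \<noteq> 0 \<Longrightarrow> th a = primitive_char chi a"
      using conductor_ex[OF 1] by blast
    have "th a = chi a" if "chi a \<noteq> 0" for a
      using th(2)[of a] 2[OF that] that by simp
    with th(1) show "conductor chi \<le> conductor (primitive_char chi)" by (rule conductor_le)
  qed
qed

lemma primitive_char_dvd_level:
  assumes "dirichlet_char m (chi :: int \<Rightarrow> 'a::field)"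
  shows "conductor chi dvd m"
  by (rule conductor_dvd[OF dirichlet_char_primitive[OF assms] primitive_char_eq[OF assms] assms])
    (simp_all add: primitive_char_eq[OF assms])

lemma dirichlet_char_times:
  assumes "dirichlet_char m1 (chi :: int \<Rightarrow> 'a::field)" "dirichlet_char m2 psi"
  shows "dirichlet_char (lcm m1 m2) (\<lambda>a. chi a * psi a)"
  unfolding dirichlet_char_def
proof (intro conjI allI impI)
  show "lcm m1 m2 > 0" using assms by (simp add: dirichlet_char_def lcm_pos_nat)
  fix a b
  show "chi (a * b) * psi (a * b) = chi a * psi a * (chi b * psi b)"
    by (simp add: dirichlet_char_mult[OF assms(1)] dirichlet_char_mult[OF assms(2)])
  have "coprime a (int (lcm m1 m2)) \<longleftrightarrow> coprime a (int m1) \<and> coprime a (int m2)"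
  proof safe
    assume *: "coprime a (int (lcm m1 m2))"
    show "coprime a (int m1)" "coprime a (int m2)"
      by (rule coprime_divisors[OF dvd_refl _ *]; simp)+
  next
    assume "coprime a (int m1)" "coprime a (int m2)"
    then have *: "coprime a (int (m1 * m2))" by simp
    show "coprime a (int (lcm m1 m2))"
      by (rule coprime_divisors[OF dvd_refl _ *]) (simp only: int_dvd_int_iff lcm_least dvd_triv_left dvd_triv_right)
  qed
  then show "chi a * psi a \<noteq> 0 \<longleftrightarrow> coprime a (int (lcm m1 m2))"
    using dirichlet_char_eq_0_iff[OF assms(1)] dirichlet_char_eq_0_iff[OF assms(2)] by auto
  assume ab: "[a = b] (mod int (lcm m1 m2))"
  have "[a = b] (mod int m1)" "[a = b] (mod int m2)"
    by (rule cong_dvd_modulus[OF ab]; simp)+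
  then show "chi a * psi a = chi b * psi b"
    using dirichlet_char_cong[OF assms(1)] dirichlet_char_cong[OF assms(2)] by metis
qed

text \<open>The exponent 0 is excluded because \<open>0 ^ 0 = 1\<close> would give a nonzero value
  at arguments not prime to the modulus.\<close>

lemma dirichlet_char_power:
  assumes "dirichlet_char m (chi :: int \<Rightarrow> 'a::field)" "n > 0"
  shows "dirichlet_char m (\<lambda>a. chi a ^ n)"
  using assms by (auto simp: dirichlet_char_def power_mult_distrib)

lemma dirichlet_char_inverse:
  assumes "dirichlet_char m (chi :: int \<Rightarrow> 'a::field)"
  shows "dirichlet_char m (\<lambda>a. inverse (chi a))"
  using assms by (auto simp: dirichlet_char_def)

context padic_field
begin

text \<open>By Euler's theorem the nonzero values are roots of unity.\<close>

lemma pabs_dirichlet_char: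
  assumes "dirichlet_char m (chi :: int \<Rightarrow> 'a)"
  shows "pabs (chi a) \<le> 1"
proof (cases "coprime a (int m)")
  case True
  have pow: "chi (a ^ n) = chi a ^ n" for n
    by (induction n) (simp_all add: dirichlet_char_1[OF assms] dirichlet_char_mult[OF assms])
  have m: "m > 0" using dirichlet_char_pos[OF assms] .
  define b where "b = nat (a mod int m)"
  have b: "[int b = a] (mod int m)" using m by (simp add: b_def)
  then have "coprime b m" using True cong_imp_coprime[OF cong_sym[OF b]] by simp
  from euler_theorem[OF this] have "[int b ^ totient m = 1] (mod int m)"
    by (metis cong_int_iff of_nat_1 of_nat_power)
  then have "chi (int b ^ totient m) = 1"
    using dirichlet_char_cong[OF assms] dirichlet_char_1[OF assms] by metis
  moreover have "chi (int b ^ totient m) = chi (a ^ totient m)"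
    by (rule dirichlet_char_cong[OF assms cong_pow[OF b]])
  ultimately have "chi a ^ totient m = 1" by (simp add: pow)
  then show ?thesis using root_of_unity_pabs[of "totient m" "chi a"] m by simp
next
  case False
  then show ?thesis using dirichlet_char_eq_0_iff[OF assms, of a] by auto
qed

end

section \<open>Bernoulli numbers\<close>

lemma fps_exp_minus_1_dvd:
  assumes "c \<noteq> (0::'a::field_char_0)"
  shows "fps_exp c - 1 dvd fps_X"
proof -
  have "subdegree (fps_exp c - 1) = 1"
    using assms by (intro subdegreeI) auto
  then show ?thesis using assms by (simp add: fps_dvd_iff)
qed

text \<open>For \<open>c = 1\<close> this is the generating function of the Bernoulli numbers with
  B_1 = -1/2. The division is exact for nonzero \<open>c\<close>, since the denominator has order
  1.\<close>

definition bernfps :: "'a::field_char_0 \<Rightarrow> 'a fps" where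
  "bernfps c = fps_X / (fps_exp c - 1)"

lemma bernfps_mult: "c \<noteq> 0 \<Longrightarrow> bernfps c * (fps_exp c - 1) = fps_X"
  unfolding bernfps_def by (rule dvd_div_mult_self[OF fps_exp_minus_1_dvd])

lemma bernfps_eqI:
  assumes "c \<noteq> 0" "f * (fps_exp c - 1) = fps_X * g"
  shows "f = bernfps c * g"
proof -
  have "f * (fps_exp c - 1) = (bernfps c * g) * (fps_exp c - 1)"
    using assms bernfps_mult[OF assms(1)] by (simp add: mult_ac)
  then show ?thesis using assms(1) by simp
qed

definition bern :: "nat \<Rightarrow> 'a::field_char_0" where
  "bern j = fact j * fps_nth (bernfps 1) j"

lemma bernfps_1_nth: "fps_nth (bernfps 1) j = bern j / fact j"
  by (simp add: bern_def)

text \<open>Substituting \<open>c * X\<close> for \<open>X\<close> in \<open>bernfps 1\<close> gives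
  \<open>c\<close> times \<open>bernfps c\<close>.\<close>

lemma bernfps_nth:
  assumes "c \<noteq> 0"
  shows "fps_nth (bernfps c) j = c ^ j * bern j / fact j / c"
proof -
  let ?l = "fps_const c * fps_X"
  have "(bernfps 1 oo ?l) * (fps_exp c - 1) = (bernfps 1 * (fps_exp 1 - 1)) oo ?l"
    by (simp add: fps_compose_mult_distrib fps_compose_sub_distrib)
  also have "\<dots> = fps_X * fps_const c" unfolding bernfps_mult[OF one_neq_zero] by simp
  finally have "bernfps 1 oo ?l = bernfps c * fps_const c" by (rule bernfps_eqI[OF assms])
  then have "fps_nth (bernfps 1 oo ?l) j = fps_nth (bernfps c) j * c" by simp
  moreover have "fps_nth (bernfps 1 oo ?l) j = c ^ j * bern j / fact j"
    by (simp add: fps_compose_linear bernfps_1_nth)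
  ultimately show ?thesis using assms by (metis nonzero_mult_div_cancel_right)
qed

lemma bern_0: "bern 0 = (1::'a::field_char_0)" and bern_1: "bern 1 = (- 1 / 2 :: 'a)"
proof -
  have *: "fps_nth (bernfps 1 * (fps_exp 1 - 1) :: 'a fps) j = fps_nth fps_X j" for j
    by (simp add: bernfps_mult)
  show 0: "bern 0 = (1::'a)"
    using *[of 1] by (simp add: fps_mult_nth bernfps_1_nth)
  show "bern 1 = (- 1 / 2 :: 'a)"
  proof -
    have "1 / 2 + bern 1 = (0::'a)"
      using *[of 2] by (simp add: fps_mult_nth bernfps_1_nth 0 numeral_2_eq_2)
    then show ?thesis by (simp add: add_eq_0_iff)
  qed
qed

text \<open>\<open>bernpoly n u x\<close> is \<open>u\<^sup>n\<close> times the value of the Bernoulli polynomial \<open>B\<^sub>n\<close> at \<open>x / u\<close>.\<close>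

definition bernpoly :: "nat \<Rightarrow> 'a::field_char_0 \<Rightarrow> 'a \<Rightarrow> 'a" where
  "bernpoly n u x = (\<Sum>j\<le>n. of_nat (n choose j) * x ^ (n - j) * u ^ j * bern j)"

lemma fps_exp_mult_nth:
  "fact n * fps_nth (fps_exp (x::'a::field_char_0) * f) n =
    (\<Sum>j\<le>n. of_nat (n choose j) * x ^ (n - j) * (fact j * fps_nth f j))"
proof -
  have "fps_nth (fps_exp x * f) n = (\<Sum>j\<le>n. fps_nth f j * (x ^ (n - j) / fact (n - j)))"
    unfolding mult.commute[of _ f] fps_mult_nth by (simp add: atMost_atLeast0)
  also have "fact n * \<dots> = (\<Sum>j\<le>n. of_nat (n choose j) * x ^ (n - j) * (fact j * fps_nth f j))"
    unfolding sum_distrib_left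
    by (intro sum.cong refl) (simp add: binomial_fact field_simps)
  finally show ?thesis .
qed

lemma bernpoly_fps:
  assumes "u \<noteq> 0"
  shows "fact n * fps_nth (fps_exp x * bernfps u) n = bernpoly n u x / u"
  unfolding fps_exp_mult_nth bernfps_nth[OF assms] bernpoly_def
  by (simp add: sum_divide_distrib mult_ac)

text \<open>On generating functions this is the law exp(x + y) = exp(x) exp(y); it later collapses a
  double sum over Bernoulli numbers to a single value.\<close>

lemma bernpoly_add:
  assumes "u \<noteq> 0"
  shows "bernpoly n u (x + y) = (\<Sum>j\<le>n. of_nat (n choose j) * x ^ (n - j) * bernpoly j u y)"
proof -
  have "bernpoly n u (x + y) / u = fact n * fps_nth (fps_exp x * (fps_exp y * bernfps u)) n"
    using bernpoly_fps[OF assms, of n "x + y"] by (simp add: fps_exp_add_mult mult.assoc)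
  also have "\<dots> = (\<Sum>j\<le>n. of_nat (n choose j) * x ^ (n - j) * bernpoly j u y) / u"
    unfolding fps_exp_mult_nth[of n x] bernpoly_fps[OF assms] by (simp add: sum_divide_distrib)
  finally show ?thesis using assms by simp
qed

lemma bernpoly_scale: "bernpoly n (c * u) (c * x) = c ^ n * bernpoly n u x"
  unfolding bernpoly_def sum_distrib_left
proof (intro sum.cong refl)
  fix j assume "j \<in> {..n}"
  then have "c ^ n = c ^ (n - j) * c ^ j" by (simp flip: power_add)
  then show "of_nat (n choose j) * (c * x) ^ (n - j) * (c * u) ^ j * bern j =
      c ^ n * (of_nat (n choose j) * x ^ (n - j) * u ^ j * bern j)"
    by (simp add: power_mult_distrib)
qed

text \<open>A geometric sum over \<open>k\<close> blocks of length \<open>g\<close>, with the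
  denominators cleared.\<close>

lemma periodic_exp_sum:
  fixes psi :: "int \<Rightarrow> 'a::field_char_0"
  assumes per: "\<And>a b. [a = b] (mod int g) \<Longrightarrow> psi a = psi b"
  shows "(\<Sum>b=1..g * k. fps_const (psi (int b)) * fps_exp (of_nat b)) * (fps_exp (of_nat g) - 1) =
    (\<Sum>b=1..g. fps_const (psi (int b)) * fps_exp (of_nat b)) * (fps_exp (of_nat (g * k)) - 1)"
proof (induction k)
  case (Suc k)
  let ?f = "\<lambda>b. fps_const (psi (int b)) * fps_exp (of_nat b)"
  have "(\<Sum>b=1..g * Suc k. ?f b) = (\<Sum>b=1..g * k. ?f b) + (\<Sum>b=1 + g * k..g + g * k. ?f b)"
    using sum.ub_add_nat[of 1 "g * k" ?f g] by (simp add: add.commute)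
  also have "(\<Sum>b=1 + g * k..g + g * k. ?f b) = (\<Sum>b=1..g. ?f (b + g * k))"
    by (rule sum.shift_bounds_cl_nat_ivl)
  also have "\<dots> = (\<Sum>b=1..g. fps_exp (of_nat (g * k)) * ?f b)"
  proof (intro sum.cong refl)
    fix b
    have "psi (int (b + g * k)) = psi (int b)" by (rule per) (simp add: cong_iff_dvd_diff)
    then show "?f (b + g * k) = fps_exp (of_nat (g * k)) * ?f b"
      by (simp add: fps_exp_add_mult mult_ac)
  qed
  also have "\<dots> = fps_exp (of_nat (g * k)) * (\<Sum>b=1..g. ?f b)" by (simp only: sum_distrib_left)
  finally have "(\<Sum>b=1..g * Suc k. ?f b) = (\<Sum>b=1..g * k. ?f b) + fps_exp (of_nat (g * k)) * (\<Sum>b=1..g. ?f b)" .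
  moreover have "fps_exp (of_nat (g * Suc k) :: 'a) = fps_exp (of_nat (g * k)) * fps_exp (of_nat g)"
    by (simp add: fps_exp_add_mult mult.commute)
  ultimately show ?case using Suc by (simp only: ring_distribs) (simp add: algebra_simps)
qed simp

text \<open>Replacing the conductor by a common multiple \<open>F\<close> lets the characters
  belonging to all \<open>n\<close> be summed over the same range.\<close>

lemma gen_bernoulli_level:
  fixes psi :: "int \<Rightarrow> 'a::field_char_0"
  assumes psi: "dirichlet_char (conductor psi) psi" and dvd: "conductor psi dvd F" and "F > 0"
  shows "gen_bernoulli n psi = (\<Sum>b=1..F. psi (int b) * bernpoly n (of_nat F) (of_nat b)) / of_nat F"
proof -
  define g where "g = conductor psi"
  have g: "(of_nat g :: 'a) \<noteq> 0" using dirichlet_char_pos[OF psi] by (simp add: g_def)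
  have F: "(of_nat F :: 'a) \<noteq> 0" using \<open>F > 0\<close> by simp
  let ?S = "\<lambda>m. \<Sum>b=1..m. fps_const (psi (int b)) * fps_exp (of_nat b)"
  obtain k where k: "F = g * k" using dvd by (auto simp: g_def)
  have "(bernfps (of_nat F) * ?S F) * (fps_exp (of_nat F) - 1) * (fps_exp (of_nat g) - 1) =
      fps_X * ?S F * (fps_exp (of_nat g) - 1)"
    using bernfps_mult[OF F] by (simp add: mult_ac)
  also have "\<dots> = fps_X * ?S g * (fps_exp (of_nat F) - 1)"
    using periodic_exp_sum[of g psi k] dirichlet_char_cong[OF psi] unfolding k
    by (simp add: g_def mult.assoc)
  finally have "(bernfps (of_nat F) * ?S F) * (fps_exp (of_nat g) - 1) = fps_X * ?S g"
    using F by (simp add: mult_ac)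
  then have eq: "bernfps (of_nat F) * ?S F = bernfps (of_nat g) * ?S g" by (rule bernfps_eqI[OF g])
  have "(\<Sum>a=1..g. fps_const (psi (int a)) * fps_X * fps_exp (of_nat a)) = fps_X * ?S g"
    by (simp add: sum_distrib_left mult_ac)
  then have "gen_bernoulli n psi = fact n * fps_nth (fps_X * ?S g / (fps_exp (of_nat g) - 1)) n"
    unfolding gen_bernoulli_def g_def by simp
  also have "fps_X * ?S g / (fps_exp (of_nat g) - 1) = bernfps (of_nat F) * ?S F"
    unfolding eq unfolding bernfps_def by (rule dvd_div_mult[OF fps_exp_minus_1_dvd[OF g], symmetric])
  also have "\<dots> = (\<Sum>b=1..F. fps_const (psi (int b)) * (fps_exp (of_nat b) * bernfps (of_nat F)))"
    by (simp add: sum_distrib_left mult_ac)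
  also have "fact n * fps_nth \<dots> n =
      (\<Sum>b=1..F. psi (int b) * (fact n * fps_nth (fps_exp (of_nat b) * bernfps (of_nat F)) n))"
    unfolding fps_sum_nth fps_mult_left_const_nth sum_distrib_left
    by (intro sum.cong refl mult.left_commute)
  also have "\<dots> = (\<Sum>b=1..F. psi (int b) * bernpoly n (of_nat F) (of_nat b)) / of_nat F"
    unfolding bernpoly_fps[OF F] by (simp add: sum_divide_distrib)
  finally show ?thesis .
qed

text \<open>The multiples of \<open>p\<close> in the full sum are \<open>p * b\<close> with
  \<open>b\<close> up to \<open>G = F div p\<close>. By homogeneity they reproduce the sum at level
  \<open>G\<close> with the factor \<open>psi p * p ^ (n - 1)\<close>; if this factor is nonzero,
  the conductor is prime to \<open>p\<close> and still divides \<open>G\<close>.\<close>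

lemma gen_bernoulli_Euler_factor:
  fixes psi :: "int \<Rightarrow> 'a::field_char_0"
  assumes psi: "dirichlet_char (conductor psi) psi" and dvd: "conductor psi dvd F" and "F > 0"
    and p: "prime p" "p dvd F" and n: "n \<ge> 1"
  shows "(\<Sum>b\<in>{b \<in> {1..F}. \<not> p dvd b}. psi (int b) * bernpoly n (of_nat F) (of_nat b)) / of_nat F =
    (1 - psi (int p) * of_nat p ^ (n - 1)) * gen_bernoulli n psi"
proof -
  obtain G where G: "F = p * G" using p(2) by auto
  have p0: "p > 0" using prime_gt_0_nat[OF p(1)] .
  then have "G > 0" using \<open>F > 0\<close> G by simp
  let ?f = "\<lambda>F b. psi (int b) * bernpoly n (of_nat F) (of_nat b)"
  have img: "{b \<in> {1..F}. p dvd b} = (\<lambda>b. p * b) ` {1..G}"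
    using p0 by (auto simp: G image_iff)
  have scale: "bernpoly n (of_nat F) (of_nat (p * b)) = of_nat p ^ n * (bernpoly n (of_nat G) (of_nat b) :: 'a)"
    for b unfolding G of_nat_mult by (rule bernpoly_scale)
  have "sum (?f F) {b \<in> {1..F}. p dvd b} = (\<Sum>b=1..G. ?f F (p * b))"
    unfolding img using p0 by (subst sum.reindex) (auto simp: inj_on_def)
  also have "\<dots> = psi (int p) * of_nat p ^ n * sum (?f G) {1..G}"
    unfolding scale by (simp add: dirichlet_char_mult[OF psi] sum_distrib_left mult_ac)
  also have "\<dots> / of_nat F = psi (int p) * of_nat p ^ (n - 1) * (sum (?f G) {1..G} / of_nat G)"
    using n p0 by (cases n) (simp_all add: G)
  also have "\<dots> = psi (int p) * of_nat p ^ (n - 1) * gen_bernoulli n psi"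
  proof (cases "psi (int p) = 0")
    case False
    then have "coprime (int p) (int (conductor psi))" using dirichlet_char_eq_0_iff[OF psi] by blast
    then have "coprime (conductor psi) p" by (simp add: coprime_commute)
    then have "conductor psi dvd G" using dvd unfolding G by (simp add: coprime_dvd_mult_right_iff)
    from gen_bernoulli_level[OF psi this \<open>G > 0\<close>] show ?thesis by simp
  qed simp
  finally have 1: "sum (?f F) {b \<in> {1..F}. p dvd b} / of_nat F =
      psi (int p) * of_nat p ^ (n - 1) * gen_bernoulli n psi" .
  have "sum (?f F) {1..F} = sum (?f F) {b \<in> {1..F}. p dvd b} + sum (?f F) {b \<in> {1..F}. \<not> p dvd b}"
    by (subst sum.union_disjoint[symmetric]) (auto intro!: sum.cong)
  then have "gen_bernoulli n psi = psi (int p) * of_nat p ^ (n - 1) * gen_bernoulli n psi +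
      sum (?f F) {b \<in> {1..F}. \<not> p dvd b} / of_nat F"
    using gen_bernoulli_level[OF psi dvd \<open>F > 0\<close>] 1 by (simp add: add_divide_distrib)
  then show ?thesis by (simp add: algebra_simps)
qed

section \<open>Integrality of \<open>p\<close> times the Bernoulli numbers\<close>

context padic_field
begin

text \<open>The valuation of k + 1 is at most that of (k + 1)!, hence at most k.\<close>

lemma pabs_power_div_Suc: "pabs (of_nat p ^ k / of_nat (Suc k) :: 'a) \<le> 1"
proof -
  have p: "p > 1" using prime_gt_1_nat[OF prime_p] .
  obtain v where v: "pabs (fact (Suc k) :: 'a) = (1 / real p) ^ v" "v * (p - 1) \<le> k"
    using pabs_fact[of "Suc k"] by auto
  have "1 \<le> p - 1" using p by linarith
  from mult_le_mono2[OF this, of v] have "v \<le> v * (p - 1)" by simp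
  from le_trans[OF this v(2)] have "(1 / real p) ^ k \<le> (1 / real p) ^ v" using p by (intro power_decreasing) auto
  also have "\<dots> = pabs (of_nat (Suc k) :: 'a) * pabs (fact k :: 'a)"
    unfolding v(1)[symmetric] pabs_mult[symmetric] by (simp only: fact_Suc)
  also have "\<dots> \<le> pabs (of_nat (Suc k) :: 'a) * 1"
    using pabs_of_nat[of "fact k"] by (intro mult_left_mono) auto
  finally have "(1 / real p) ^ k \<le> pabs (of_nat (Suc k) :: 'a)" by simp
  then show ?thesis unfolding pabs_divide pabs_power pabs_p
    by (intro divide_le_eq_1[THEN iffD2] disjI1 conjI) (auto simp del: of_nat_Suc)
qed

text \<open>The classical formula for sums of \<open>n\<close>-th powers, from the geometric sum of
  the exponentials. The factors are grouped so that in each term with \<open>j < n\<close> both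
  \<open>p * bern j\<close> and the final quotient are integral.\<close>

lemma bern_recurrence:
  "(\<Sum>i<p. of_nat i ^ n :: 'a) =
    (\<Sum>j\<le>n. of_nat (n choose j) * (of_nat p * bern j) * (of_nat p ^ (n - j) / of_nat (Suc (n - j))))"
proof -
  have "(\<Sum>i<p. fps_exp (of_nat i :: 'a)) * (fps_exp 1 - 1) = fps_exp (of_nat p) - 1"
    using power_diff_1_eq[of "fps_exp (1::'a)" p] by (simp add: fps_exp_power_mult mult.commute)
  then have "bernfps 1 * (fps_exp (of_nat p) - 1) =
      bernfps 1 * (fps_exp 1 - 1) * (\<Sum>i<p. fps_exp (of_nat i :: 'a))" by (simp add: mult_ac)
  also have "\<dots> = fps_X * (\<Sum>i<p. fps_exp (of_nat i :: 'a))" by (simp add: bernfps_mult)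
  finally have "fps_nth (fps_X * (\<Sum>i<p. fps_exp (of_nat i :: 'a))) (Suc n) =
      fps_nth (bernfps 1 * (fps_exp (of_nat p) - 1)) (Suc n)" by simp
  moreover have "fps_nth (fps_X * (\<Sum>i<p. fps_exp (of_nat i :: 'a))) (Suc n) =
      (\<Sum>i<p. of_nat i ^ n / fact n)" by (simp add: fps_sum_nth)
  moreover have "fps_nth (bernfps 1 * (fps_exp (of_nat p) - 1)) (Suc n) =
      (\<Sum>j\<le>n. bern j / fact j * (of_nat p ^ (Suc n - j) / fact (Suc n - j)) :: 'a)"
    by (auto simp: fps_mult_nth bernfps_1_nth atLeast0AtMost Suc_diff_le intro!: sum.cong)
  ultimately have "(\<Sum>i<p. of_nat i ^ n / fact n :: 'a) =
      (\<Sum>j\<le>n. bern j / fact j * (of_nat p ^ (Suc n - j) / fact (Suc n - j)))"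
    by simp
  then have "(\<Sum>i<p. of_nat i ^ n :: 'a) =
      fact n * (\<Sum>j\<le>n. bern j / fact j * (of_nat p ^ (Suc n - j) / fact (Suc n - j)))"
    by (simp add: field_simps flip: sum_divide_distrib)
  also have "\<dots> = (\<Sum>j\<le>n. of_nat (n choose j) * (of_nat p * bern j) * (of_nat p ^ (n - j) / of_nat (Suc (n - j))))"
    unfolding sum_distrib_left
  proof (intro sum.cong refl)
    fix j assume "j \<in> {..n}"
    then have j: "j \<le> n" by simp
    then have "Suc n - j = Suc (n - j)" by simp
    then show "fact n * (bern j / fact j * (of_nat p ^ (Suc n - j) / fact (Suc n - j))) =
        of_nat (n choose j) * (of_nat p * bern j) * (of_nat p ^ (n - j) / of_nat (Suc (n - j)) :: 'a)"
      by (simp add: binomial_fact[OF j] mult_ac del: of_nat_Suc)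
  qed
  finally show ?thesis .
qed

text \<open>The term \<open>j = n\<close> of the recurrence is \<open>p * bern n\<close> itself, and
  everything else in it is integral by induction.\<close>

lemma pabs_p_bern: "pabs (of_nat p * bern n :: 'a) \<le> 1"
proof (induction n rule: less_induct)
  case (less n)
  let ?t = "\<lambda>j. of_nat (n choose j) * (of_nat p * bern j) * (of_nat p ^ (n - j) / of_nat (Suc (n - j))) :: 'a"
  have "(\<Sum>i<p. of_nat i ^ n :: 'a) = (\<Sum>j<n. ?t j) + of_nat p * bern n"
    unfolding bern_recurrence by (simp add: lessThan_Suc_atMost[symmetric])
  then have eq: "of_nat p * bern n = (\<Sum>i<p. of_nat i ^ n :: 'a) - (\<Sum>j<n. ?t j)" by simp
  have "pabs (\<Sum>i<p. of_nat i ^ n :: 'a) \<le> 1"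
    using pabs_of_nat[of "\<Sum>i<p. i ^ n"] by simp
  moreover have "pabs (\<Sum>j<n. ?t j) \<le> 1"
  proof (intro pabs_sum_le)
    fix j assume "j \<in> {..<n}"
    then show "pabs (?t j) \<le> 1" unfolding pabs_mult[of "_ * _" "_ / _"] pabs_mult[of "of_nat (n choose j)"]
      using less[of j] by (intro mult_le_one pabs_power_div_Suc pabs_of_nat) auto
  qed simp
  ultimately show ?case unfolding eq by (intro order_trans[OF pabs_diff] max.boundedI)
qed

lemma pabs_bern: "pabs (bern n :: 'a) \<le> real p"
  using pabs_p_bern[of n] prime_gt_0_nat[OF prime_p] by (simp add: pabs_mult pabs_p field_simps)

lemma pabs_bernpoly: "pabs (bernpoly n (of_nat u) (of_nat x) :: 'a) \<le> real p"
  unfolding bernpoly_def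
proof (intro pabs_sum_le)
  fix j
  have "pabs (of_nat (n choose j) * of_nat x ^ (n - j) * of_nat u ^ j :: 'a) \<le> 1"
    using pabs_of_nat[of "(n choose j) * x ^ (n - j) * u ^ j"] by simp
  from mult_mono[OF this pabs_bern[of j]]
  show "pabs (of_nat (n choose j) * of_nat x ^ (n - j) * of_nat u ^ j * bern j :: 'a) \<le> real p"
    by (simp add: pabs_mult)
qed simp

end

section \<open>The p-adic L-function\<close>

text \<open>The crude constant \<open>C\<close> only ensures convergence. The sharper
  \<open>D\<close> holds from index 1 on, and replacing \<open>w 0\<close> by 0 makes it a bound at
  every index.\<close>

lemma (in padic_field) binser_tail_le:
  assumes C: "\<And>j. pabs (w j) \<le> C / real (padic_q p) ^ j"
    and D: "\<And>j. j \<ge> 1 \<Longrightarrow> pabs (w j) \<le> D / real (padic_q p) ^ j" "D \<ge> 0"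
    and s: "pabs (s::'a) < padic_radius p"
  shows "pabs (binser w s - w 0) \<le> D"
proof (rule sums_le_padic)
  show "(\<lambda>j. ((- s) gchoose (j + 1)) / of_nat (Suc (j + 1)) * w (j + 1)) sums (binser w s - w 0)"
    using sums_tail_padic[OF binser_sums[OF C s], of 1] by simp
  fix j
  have D': "pabs ((w(0 := 0)) j) \<le> D / real (padic_q p) ^ j" for j
    using D by (cases "j = 0") auto
  have "pabs (((- s) gchoose (j + 1)) / of_nat (Suc (j + 1)) * (w(0 := 0)) (j + 1)) \<le> D"
    by (rule order_trans[OF binser_term_le[OF D' s] binser_bound_tendsto(2)[OF D' s]])
  then show "pabs (((- s) gchoose (j + 1)) / of_nat (Suc (j + 1)) * w (j + 1)) \<le> D" by simp
qed

text \<open>If \<open>D j\<close> is read as a power D^j, the right-hand side is (1 + x D)^n. The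
  left-hand side is the value at \<open>s = 1 - n\<close> of its interpolation by the exponent 1 -
  s.\<close>

lemma (in padic_field) binser_moment:
  assumes "n \<ge> 1"
  shows "D 0 + of_nat n * binser (\<lambda>j. x ^ Suc j * D (Suc j)) (1 - of_nat n) =
    (\<Sum>j\<le>n. of_nat (n choose j) * x ^ j * D j)"
proof -
  have "(\<Sum>j\<le>n. of_nat (n choose j) * x ^ j * D j) =
      D 0 + (\<Sum>j<n. of_nat (n choose Suc j) * x ^ Suc j * D (Suc j))"
    by (simp add: lessThan_Suc_atMost[symmetric] sum.lessThan_Suc_shift del: power_Suc sum.lessThan_Suc)
  then show ?thesis unfolding binser_nat[OF assms] by (simp add: mult.assoc)
qed

lemma (in padic_field) pabs_one_minus_nat: "pabs (1 - of_nat n :: 'a) < padic_radius p"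
  using pabs_of_int[of "1 - int n"] padic_radius_gt_1 by simp

section \<open>The explicit formula and its interpolation values\<close>

locale padic_L_setup = padic_field p K for p and K :: "'a::{field_char_0,complete_space} itself" +
  fixes f F :: nat and chi :: "int \<Rightarrow> 'a"
  assumes chi: "dirichlet_char f chi" and conductor_chi: "conductor chi = f"
    and F_pos: "F > 0" and q_dvd_F: "padic_q p dvd F" and f_dvd_F: "f dvd F"
begin

definition units :: "nat set" where
  "units = {b \<in> {1..F}. \<not> p dvd b}"

lemma units_D:
  assumes "b \<in> units"
  shows "b > 0" "b \<le> F" "\<not> p dvd b" "\<not> int p dvd int b" "(of_nat b :: 'a) \<noteq> 0" "pabs (of_nat b :: 'a) = 1"
  using assms pabs_of_nat_coprime by (auto simp: units_def)

lemma p_dvd_F: "p dvd F"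
  using dvd_trans[OF p_dvd_padic_q q_dvd_F] .

lemma F_nonzero: "(of_nat F :: 'a) \<noteq> 0"
  using F_pos by simp

lemma pabs_F: "pabs (of_nat F :: 'a) \<le> 1 / real (padic_q p)"
  using pabs_of_int_dvd[of "padic_q p" "int F"] q_dvd_F by (simp add: pabs_padic_q)

lemma pabs_F_power:
  assumes "b \<in> units"
  shows "pabs ((of_nat F / of_nat b) ^ Suc j :: 'a) \<le> 1 / real (padic_q p) ^ j"
proof -
  have "pabs ((of_nat F / of_nat b) ^ Suc j :: 'a) = pabs (of_nat F :: 'a) * pabs (of_nat F :: 'a) ^ j"
    unfolding power_Suc pabs_mult pabs_power pabs_divide units_D(6)[OF assms] by simp
  also have "\<dots> \<le> 1 * (1 / real (padic_q p)) ^ j"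
    by (intro mult_mono power_mono pabs_F pabs_of_nat) auto
  finally show ?thesis by (simp add: power_divide)
qed

text \<open>The plain product of characters, which can be imprimitive; \<open>char_twist\<close> is
  its primitive version.\<close>

definition twist :: "nat \<Rightarrow> int \<Rightarrow> 'a" where
  "twist n a = chi a * inverse (teich p a) ^ n"

lemma twist_char:
  assumes "n \<ge> 1"
  shows "dirichlet_char (lcm f (padic_q p)) (twist n)"
proof -
  have "twist n = (\<lambda>a. chi a * (inverse (teich p a)) ^ n)" by (simp add: twist_def fun_eq_iff)
  then show ?thesis
    using dirichlet_char_times[OF chi dirichlet_char_power[OF dirichlet_char_inverse[OF dirichlet_char_teich]]]
      assms by simp
qed

lemma twist_cong:
  assumes "n \<ge> 1" "[a = b] (mod int F)"
  shows "twist n a = twist n b"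
proof -
  have "int (lcm f (padic_q p)) dvd int F"
    using lcm_least[OF f_dvd_F q_dvd_F] by (simp only: int_dvd_int_iff)
  then show ?thesis
    by (intro dirichlet_char_cong[OF twist_char[OF assms(1)]] cong_dvd_modulus[OF assms(2)])
qed

lemma chi_diamond_power:
  assumes "\<not> int p dvd a"
  shows "chi a * diamond p a ^ n = twist n a * of_int a ^ n"
  using assms by (simp add: twist_def diamond_def power_divide field_simps)

text \<open>Passing to the primitive character changes values only at multiples of \<open>p\<close>.
  Multiplying it back by the \<open>n\<close>-th power of \<open>teich\<close> gives a character
  that agrees with \<open>chi\<close> wherever both are nonzero, so \<open>f\<close> divides its
  modulus. Hence a zero of \<open>chi\<close> prime to \<open>p\<close> is also a zero of the
  primitive character.\<close>

lemma twist_eq_primitive: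
  assumes n: "n \<ge> 1" and a: "\<not> int p dvd a"
  shows "twist n a = primitive_char (twist n) a"
proof (cases "twist n a = 0")
  case False
  then show ?thesis using primitive_char_eq[OF twist_char[OF n]] by simp
next
  case True
  note prim = dirichlet_char_primitive[OF twist_char[OF n]]
  let ?psi = "\<lambda>a. primitive_char (twist n) a * teich p a ^ n"
  have psi: "dirichlet_char (lcm (conductor (twist n)) (padic_q p)) ?psi"
    using n by (intro dirichlet_char_times prim dirichlet_char_power dirichlet_char_teich) simp
  have agree: "?psi b = chi b" if "chi b \<noteq> 0" "?psi b \<noteq> 0" for b
  proof -
    have t: "teich p b \<noteq> (0::'a)" using that n by (auto simp: zero_power)
    then have "twist n b \<noteq> 0" using that by (simp add: twist_def)
    then have "primitive_char (twist n) b = twist n b" by (rule primitive_char_eq[OF twist_char[OF n]])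
    then show ?thesis using t by (simp add: twist_def field_simps)
  qed
  have "conductor chi dvd lcm (conductor (twist n)) (padic_q p)"
    by (rule conductor_dvd[of chi chi, OF _ _ psi agree]) (use chi conductor_chi in auto)
  then have dvd: "int f dvd int (lcm (conductor (twist n)) (padic_q p))"
    by (simp only: conductor_chi int_dvd_int_iff)
  have "teich p a \<noteq> (0::'a)" using pabs_teich[OF a] by auto
  moreover from this True have "chi a = 0" by (simp add: twist_def)
  then have "\<not> coprime a (int f)" using dirichlet_char_eq_0_iff[OF chi] by blast
  then have "\<not> coprime a (int (lcm (conductor (twist n)) (padic_q p)))"
    using coprime_divisors[OF dvd_refl dvd] by blast
  then have "?psi a = 0" using dirichlet_char_eq_0_iff[OF psi, of a] by blast
  ultimately have "primitive_char (twist n) a = 0" by simp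
  then show ?thesis using True by simp
qed

text \<open>By \<open>moment_eq\<close> this is -n L_p(1 - n, chi).\<close>

definition moment :: "nat \<Rightarrow> 'a" where
  "moment n = (\<Sum>b\<in>units. twist n (int b) * bernpoly n (of_nat F) (of_nat b)) / of_nat F"

lemma moment_eq:
  assumes n: "n \<ge> 1"
  shows "moment n = (1 - char_twist p chi n (int p) * of_nat p ^ (n - 1)) * gen_bernoulli n (char_twist p chi n)"
proof -
  note tc = twist_char[OF n]
  define psi where "psi = primitive_char (twist n)"
  have ct: "char_twist p chi n = psi" by (simp add: char_twist_def psi_def twist_def[abs_def])
  have c: "conductor psi = conductor (twist n)" unfolding psi_def by (rule conductor_primitive[OF tc])
  have psi: "dirichlet_char (conductor psi) psi"
    unfolding c unfolding psi_def by (rule dirichlet_char_primitive[OF tc])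
  have "conductor psi dvd F"
    unfolding c using primitive_char_dvd_level[OF tc] f_dvd_F q_dvd_F by (meson dvd_trans lcm_least)
  from gen_bernoulli_Euler_factor[OF psi this F_pos prime_p p_dvd_F n]
  have "(\<Sum>b\<in>units. psi (int b) * bernpoly n (of_nat F) (of_nat b)) / of_nat F =
      (1 - psi (int p) * of_nat p ^ (n - 1)) * gen_bernoulli n psi"
    unfolding units_def .
  moreover have "moment n = (\<Sum>b\<in>units. psi (int b) * bernpoly n (of_nat F) (of_nat b)) / of_nat F"
    unfolding moment_def psi_def using twist_eq_primitive[OF n] units_D(4)
    by (intro arg_cong2[where f = "(/)"] sum.cong refl) auto
  ultimately show ?thesis unfolding ct by simp
qed

text \<open>The inner series of the explicit formula without its term j = 0, divided by 1 -
  s.\<close>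

definition bern_ser :: "nat \<Rightarrow> 'a \<Rightarrow> 'a" where
  "bern_ser b = binser (\<lambda>j. (of_nat F / of_nat b) ^ Suc j * bern (Suc j))"

text \<open>\<open>(s - 1) L\<^sub>p(s, chi)\<close>, given by the explicit formula.\<close>

definition L_num :: "'a \<Rightarrow> 'a" where
  "L_num s = (\<Sum>b\<in>units. chi (int b) * diamond_pow p (int b) (1 - s) * (1 + (1 - s) * bern_ser b s)) / of_nat F"

lemma bern_ser_analytic:
  assumes "b \<in> units"
  shows "analytic_on_disc (padic_radius p) (bern_ser b)"
  unfolding bern_ser_def
proof (rule binser_analytic)
  show "pabs ((of_nat F / of_nat b) ^ Suc j * bern (Suc j) :: 'a) \<le> real p / real (padic_q p) ^ j" for j
    using mult_mono[OF pabs_F_power[OF assms, of j] pabs_bern[of "Suc j"]]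
    by (simp add: pabs_mult del: power_Suc)
qed

lemma analytic_divide: "analytic_on_disc r (g :: 'a \<Rightarrow> 'a) \<Longrightarrow> analytic_on_disc r (\<lambda>s. g s / c)"
  using analytic_cmult[of r g "1 / c"] by simp

lemma L_num_analytic: "analytic_on_disc (padic_radius p) L_num"
  unfolding L_num_def
  by (intro analytic_divide analytic_sum analytic_mult analytic_add analytic_const analytic_diff
      analytic_ident bern_ser_analytic analytic_diamond_pow_one_minus units_D(4))

lemma bernpoly_power_sum:
  assumes "(b::'a) \<noteq> 0"
  shows "b ^ n * (\<Sum>j\<le>n. of_nat (n choose j) * (u / b) ^ j * D j) =
    (\<Sum>j\<le>n. of_nat (n choose j) * b ^ (n - j) * u ^ j * D j)"
  unfolding sum_distrib_left
proof (intro sum.cong refl)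
  fix j assume "j \<in> {..n}"
  then have "b ^ n = b ^ (n - j) * b ^ j" by (simp flip: power_add)
  then show "b ^ n * (of_nat (n choose j) * (u / b) ^ j * D j) =
      of_nat (n choose j) * b ^ (n - j) * u ^ j * D j"
    using assms by (simp add: power_divide)
qed

lemma L_num_nat:
  assumes n: "n \<ge> 1"
  shows "L_num (1 - of_nat n) = moment n"
  unfolding L_num_def moment_def
proof (intro arg_cong2[where f = "(/)"] sum.cong refl)
  fix b assume b: "b \<in> units"
  have "1 + (1 - (1 - of_nat n)) * bern_ser b (1 - of_nat n) =
      (\<Sum>j\<le>n. of_nat (n choose j) * (of_nat F / of_nat b) ^ j * bern j :: 'a)"
    using binser_moment[OF n, of bern "of_nat F / of_nat b"] by (simp add: bern_ser_def bern_0)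
  moreover have "chi (int b) * diamond_pow p (int b) (1 - (1 - of_nat n)) = twist n (int b) * of_nat b ^ n"
    using chi_diamond_power[OF units_D(4)[OF b], of n] by (simp add: diamond_pow_of_nat)
  ultimately show "chi (int b) * diamond_pow p (int b) (1 - (1 - of_nat n)) * (1 + (1 - (1 - of_nat n)) * bern_ser b (1 - of_nat n)) =
      twist n (int b) * bernpoly n (of_nat F) (of_nat b)"
    using bernpoly_power_sum[OF units_D(5)[OF b], of n "of_nat F" bern]
    by (simp add: mult.assoc bernpoly_def)
qed

section \<open>Residue and regular part at 1\<close>

definition L_res :: 'a where
  "L_res = (\<Sum>b\<in>units. chi (int b)) / of_nat F"

text \<open>The constant term 1 of each power of \<open>diamond\<close> contributes to the residue
  \<open>L_res\<close>; everything else in \<open>L_num\<close> carries a factor 1 - s, and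
  \<open>L_reg\<close> is what remains after dividing it by s - 1.\<close>

definition L_reg :: "'a \<Rightarrow> 'a" where
  "L_reg s = - (\<Sum>b\<in>units. chi (int b) * (binser (\<lambda>j. (diamond p (int b) - 1) ^ Suc j) s +
      diamond_pow p (int b) (1 - s) * bern_ser b s)) / of_nat F"

lemma L_reg_analytic: "analytic_on_disc (padic_radius p) L_reg"
proof -
  have "analytic_on_disc (padic_radius p) (binser (\<lambda>j. (diamond p (int b) - 1) ^ Suc j))"
    if "b \<in> units" for b
    by (rule binser_analytic[OF pabs_diamond_power_Suc_le[OF units_D(4)[OF that]]])
  then have "analytic_on_disc (padic_radius p) (\<lambda>s. (\<Sum>b\<in>units. chi (int b) *
      (binser (\<lambda>j. (diamond p (int b) - 1) ^ Suc j) s + diamond_pow p (int b) (1 - s) * bern_ser b s)) / (- of_nat F))"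
    by (intro analytic_divide analytic_sum analytic_mult analytic_add analytic_const
        bern_ser_analytic analytic_diamond_pow_one_minus units_D(4))
  then show ?thesis by (simp add: L_reg_def[abs_def])
qed

lemma L_num_eq:
  assumes s: "pabs s < padic_radius p"
  shows "L_num s = L_res + (s - 1) * L_reg s"
proof -
  have "L_num s * of_nat F = (\<Sum>b\<in>units. chi (int b) * diamond_pow p (int b) (1 - s) * (1 + (1 - s) * bern_ser b s))"
    using F_nonzero by (simp add: L_num_def)
  also have "\<dots> = (\<Sum>b\<in>units. chi (int b) + (1 - s) * (chi (int b) *
      (binser (\<lambda>j. (diamond p (int b) - 1) ^ Suc j) s + diamond_pow p (int b) (1 - s) * bern_ser b s)))"
  proof (intro sum.cong refl)
    fix b assume b: "b \<in> units"
    have "diamond_pow p (int b) (1 - s) * (1 + (1 - s) * bern_ser b s) =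
        diamond_pow p (int b) (1 - s) + (1 - s) * (diamond_pow p (int b) (1 - s) * bern_ser b s)"
      by (simp only: distrib_left mult_1_right mult.left_commute)
    also have "\<dots> = 1 + (1 - s) * (binser (\<lambda>j. (diamond p (int b) - 1) ^ Suc j) s +
        diamond_pow p (int b) (1 - s) * bern_ser b s)"
      using diamond_pow_one_minus[OF units_D(4)[OF b] s] by (simp only: distrib_left add.assoc)
    finally have eq: "diamond_pow p (int b) (1 - s) * (1 + (1 - s) * bern_ser b s) =
        1 + (1 - s) * (binser (\<lambda>j. (diamond p (int b) - 1) ^ Suc j) s +
        diamond_pow p (int b) (1 - s) * bern_ser b s)" .
    show "chi (int b) * diamond_pow p (int b) (1 - s) * (1 + (1 - s) * bern_ser b s) =
        chi (int b) + (1 - s) * (chi (int b) *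
      (binser (\<lambda>j. (diamond p (int b) - 1) ^ Suc j) s + diamond_pow p (int b) (1 - s) * bern_ser b s))"
      unfolding mult.assoc[of "chi (int b)" "diamond_pow p (int b) (1 - s)"] eq
        distrib_left[of "chi (int b)" 1] mult_1_right by (simp only: mult.left_commute)
  qed
  also have "\<dots> = (L_res + (s - 1) * L_reg s) * of_nat F"
    unfolding sum.distrib sum_distrib_left[symmetric] L_res_def L_reg_def
    using F_nonzero by (simp add: field_simps)
  finally show ?thesis using F_nonzero by simp
qed

section \<open>The difference attached to multiplication by \<open>c\<close>\<close>

definition mult_index :: "nat \<Rightarrow> nat \<Rightarrow> nat" where
  "mult_index c b = nat ((- int b * modular_inverse (int c) (int F)) mod int c)"

definition diff_coeff :: "nat \<Rightarrow> nat \<Rightarrow> nat \<Rightarrow> 'a" where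
  "diff_coeff c b j = bernpoly j (of_nat c) (of_nat (mult_index c b)) - bern j"

definition diff_ser :: "nat \<Rightarrow> nat \<Rightarrow> 'a \<Rightarrow> 'a" where
  "diff_ser c b = binser (\<lambda>j. (of_nat F / of_nat b) ^ Suc j * diff_coeff c b (Suc j))"

text \<open>Since \<open>diff_coeff\<close> vanishes at index 0, the difference of the two Bernoulli
  series is divisible by 1 - s. This is the quotient, so it has no pole at 1; the sign of
  \<open>- of_nat F\<close> comes from dividing by s - 1 instead.\<close>

definition H_ser :: "nat \<Rightarrow> 'a \<Rightarrow> 'a" where
  "H_ser c s = (\<Sum>b\<in>units. chi (int b) * diamond_pow p (int b) (1 - s) * diff_ser c b s) / (- of_nat F)"

lemma diff_coeff_le: "pabs (diff_coeff c b j) \<le> real p"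
  unfolding diff_coeff_def
  by (intro order_trans[OF pabs_diff[of "bernpoly _ _ _"]] max.boundedI pabs_bernpoly pabs_bern)

lemma diff_ser_bound:
  assumes "b \<in> units"
  shows "pabs ((of_nat F / of_nat b) ^ Suc j * diff_coeff c b (Suc j)) \<le> real p / real (padic_q p) ^ j"
  using mult_mono[OF pabs_F_power[OF assms, of j] diff_coeff_le[of c b "Suc j"]]
  by (simp add: pabs_mult del: power_Suc)

lemma diff_ser_analytic: "b \<in> units \<Longrightarrow> analytic_on_disc (padic_radius p) (diff_ser c b)"
  unfolding diff_ser_def by (rule binser_analytic[OF diff_ser_bound])

lemma H_ser_analytic: "analytic_on_disc (padic_radius p) (H_ser c)"
  unfolding H_ser_def
  by (intro analytic_divide analytic_sum analytic_mult analytic_const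
      diff_ser_analytic analytic_diamond_pow_one_minus units_D(4))

context
  fixes c :: nat
  assumes c: "c > 1" "coprime c F"
begin

lemma p_not_dvd_c: "\<not> int p dvd int c"
proof
  assume "int p dvd int c"
  then have "is_unit p" using coprime_common_divisor[OF c(2) _ p_dvd_F] by simp
  then show False using prime_gt_1_nat[OF prime_p] by simp
qed

lemma mult_index_less: "mult_index c b < c"
  and int_mult_index: "int (mult_index c b) = (- int b * modular_inverse (int c) (int F)) mod int c"
  using c by (simp_all add: mult_index_def nat_less_iff)

lemma c_dvd_mult_index: "c dvd b + F * mult_index c b"
proof -
  have "[int F * modular_inverse (int c) (int F) = 1] (mod int c)"
    using c by (intro cong_modular_inverse1) (simp add: coprime_commute)
  then have "[- int b * (int F * modular_inverse (int c) (int F)) = - int b * 1] (mod int c)"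
    by (rule cong_scalar_left)
  moreover have "[int F * int (mult_index c b) = int F * (- int b * modular_inverse (int c) (int F))] (mod int c)"
    unfolding int_mult_index by (intro cong_scalar_left) (simp add: cong_def)
  ultimately have "[int F * int (mult_index c b) = - int b] (mod int c)"
    by (auto simp: mult.left_commute intro: cong_trans)
  then have "int c dvd int F * int (mult_index c b) + int b" by (simp add: cong_iff_dvd_diff)
  then have "int c dvd int (b + F * mult_index c b)" by (simp add: add.commute)
  then show ?thesis by (simp only: int_dvd_int_iff)
qed

definition quot_index :: "nat \<Rightarrow> nat" where
  "quot_index b = (b + F * mult_index c b) div c"

lemma quot_index_mult: "c * quot_index b = b + F * mult_index c b"
  unfolding quot_index_def by (rule dvd_mult_div_cancel[OF c_dvd_mult_index])

text \<open>\<open>c * quot_index b\<close> determines \<open>b\<close> modulo \<open>F\<close>, and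
  \<open>b + F * mult_index c b \<le> c * F\<close> because the index is below
  \<open>c\<close>.\<close>

lemma bij_quot_index: "bij_betw quot_index units units"
proof -
  have inj: "inj_on quot_index units"
  proof
    fix b b' assume b: "b \<in> units" "b' \<in> units" "quot_index b = quot_index b'"
    then have "b + F * mult_index c b = b' + F * mult_index c b'"
      using quot_index_mult by metis
    then have "[b = b'] (mod F)" by (metis cong_def mod_mult_self2)
    \<comment> \<open>The range is 1 to \<open>F\<close>, so \<open>F\<close> itself, whose residue
      is 0, is treated apart.\<close>
    moreover have "b = b' \<or> (b < F \<and> b' < F) \<or> (b = F \<and> b' < F) \<or> (b' = F \<and> b < F)"
      using units_D[OF b(1)] units_D[OF b(2)] by linarith
    ultimately show "b = b'" using units_D[OF b(1)] units_D[OF b(2)]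
      by (auto simp: cong_def)
  qed
  have "quot_index b \<in> units" if b: "b \<in> units" for b
  proof -
    have "quot_index b > 0" using quot_index_mult[of b] units_D(1)[OF b] by (cases "quot_index b = 0") auto
    moreover have "quot_index b \<le> F"
    proof -
      have "Suc (mult_index c b) \<le> c" using mult_index_less[of b] by simp
      from mult_le_mono2[OF this, of F] have "c * quot_index b \<le> c * F"
        unfolding quot_index_mult using units_D(2)[OF b] by (simp add: mult.commute)
      then show ?thesis using c by simp
    qed
    moreover have "\<not> p dvd quot_index b"
    proof
      assume "p dvd quot_index b"
      then have "p dvd b + F * mult_index c b" unfolding quot_index_mult[symmetric] by simp
      then have "p dvd b" using p_dvd_F by (simp add: dvd_add_left_iff)
      then show False using units_D(3)[OF b] by simp
    qed
    ultimately show ?thesis by (simp add: units_def)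
  qed
  then have "quot_index ` units \<subseteq> units" by blast
  moreover have "finite units" by (simp add: units_def)
  ultimately show ?thesis using inj endo_inj_surj[of units quot_index] unfolding bij_betw_def by simp
qed

text \<open>Write \<open>a\<close> for \<open>quot_index b\<close>. The addition and scaling laws of
  \<open>bernpoly\<close> turn the term of \<open>b\<close> into
  \<open>c ^ n * bernpoly n F a - bernpoly n F b\<close>. Since \<open>b\<close> is congruent to
  \<open>c * a\<close> modulo \<open>F\<close>, the twist at \<open>b\<close> factors, and
  reindexing by \<open>a\<close> produces the same moment twice.\<close>

lemma H_ser_nat:
  assumes n: "n \<ge> 1"
  shows "of_nat n * H_ser c (1 - of_nat n) =
    (1 - chi (int c) * diamond_pow p (int c) (of_nat n)) * moment n"
proof -
  have F': "(of_nat (F * c) :: 'a) \<noteq> 0" "(of_nat c :: 'a) \<noteq> 0" using F_pos c by auto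
  have "of_nat n * H_ser c (1 - of_nat n) * (- of_nat F) =
      of_nat n * (\<Sum>b\<in>units. chi (int b) * diamond_pow p (int b) (of_nat n) * diff_ser c b (1 - of_nat n))"
    unfolding H_ser_def using F_nonzero by simp
  also have "\<dots> = (\<Sum>b\<in>units. chi (int b) * diamond p (int b) ^ n * (of_nat n * diff_ser c b (1 - of_nat n)))"
    unfolding sum_distrib_left diamond_pow_of_nat by (intro sum.cong refl) (simp only: mult_ac)
  also have "\<dots> = (\<Sum>b\<in>units. twist n (int c) * of_nat c ^ n * (twist n (int (quot_index b)) * bernpoly n (of_nat F) (of_nat (quot_index b)))
      - twist n (int b) * bernpoly n (of_nat F) (of_nat b))"
  proof (intro sum.cong refl)
    fix b assume b: "b \<in> units"
    let ?k = "mult_index c b"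
    have D0: "diff_coeff c b 0 = 0" by (simp add: diff_coeff_def bernpoly_def bern_0)
    \<comment> \<open>Homogeneity moves \<open>F ^ j\<close> inside, which gives the sum the shape
      required by \<open>bernpoly_add\<close>.\<close>
    have Fk: "of_nat F ^ j * bernpoly j (of_nat c) (of_nat ?k) = bernpoly j (of_nat (F * c)) (of_nat (F * ?k) :: 'a)" for j
      by (simp only: of_nat_mult bernpoly_scale)
    have "of_nat b ^ n * (of_nat n * diff_ser c b (1 - of_nat n)) =
        of_nat b ^ n * (\<Sum>j\<le>n. of_nat (n choose j) * (of_nat F / of_nat b) ^ j * diff_coeff c b j)"
      using binser_moment[OF n, of "diff_coeff c b" "of_nat F / of_nat b"] by (simp add: diff_ser_def D0)
    also have "\<dots> = (\<Sum>j\<le>n. of_nat (n choose j) * of_nat b ^ (n - j) * of_nat F ^ j * diff_coeff c b j)"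
      by (rule bernpoly_power_sum[OF units_D(5)[OF b]])
    also have "\<dots> = (\<Sum>j\<le>n. of_nat (n choose j) * of_nat b ^ (n - j) * bernpoly j (of_nat (F * c)) (of_nat (F * ?k)))
        - bernpoly n (of_nat F) (of_nat b)"
      unfolding Fk[symmetric] bernpoly_def[of n] sum_subtractf[symmetric] diff_coeff_def
      by (intro sum.cong refl) (simp add: algebra_simps)
    also have "\<dots> = bernpoly n (of_nat (F * c)) (of_nat (b + F * ?k)) - bernpoly n (of_nat F) (of_nat b)"
      using bernpoly_add[OF F'(1), of n "of_nat b" "of_nat (F * ?k)"] by simp
    also have "of_nat (b + F * ?k) = (of_nat c * of_nat (quot_index b) :: 'a)"
      by (simp only: quot_index_mult[symmetric] of_nat_mult)
    also have "of_nat (F * c) = (of_nat c * of_nat F :: 'a)" by (simp add: mult.commute)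
    also have "bernpoly n (of_nat c * of_nat F) (of_nat c * of_nat (quot_index b)) =
        of_nat c ^ n * bernpoly n (of_nat F) (of_nat (quot_index b) :: 'a)" by (rule bernpoly_scale)
    finally have main: "of_nat b ^ n * (of_nat n * diff_ser c b (1 - of_nat n)) =
        of_nat c ^ n * bernpoly n (of_nat F) (of_nat (quot_index b)) - bernpoly n (of_nat F) (of_nat b)" .
    have "[int b = int c * int (quot_index b)] (mod int F)"
      using quot_index_mult[of b] by (simp add: cong_iff_dvd_diff flip: of_nat_mult)
    then have "twist n (int b) = twist n (int c * int (quot_index b))" by (rule twist_cong[OF n])
    also have "\<dots> = twist n (int c) * twist n (int (quot_index b))"
      by (rule dirichlet_char_mult[OF twist_char[OF n]])
    finally have tw: "twist n (int b) = twist n (int c) * twist n (int (quot_index b))" .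
    have "chi (int b) * diamond p (int b) ^ n * (of_nat n * diff_ser c b (1 - of_nat n)) =
        twist n (int b) * (of_nat b ^ n * (of_nat n * diff_ser c b (1 - of_nat n)))"
      unfolding chi_diamond_power[OF units_D(4)[OF b]] by (simp add: mult.assoc)
    also have "\<dots> = twist n (int b) * (of_nat c ^ n * bernpoly n (of_nat F) (of_nat (quot_index b)))
        - twist n (int b) * bernpoly n (of_nat F) (of_nat b)"
      unfolding main by (rule right_diff_distrib)
    also have "twist n (int b) * (of_nat c ^ n * bernpoly n (of_nat F) (of_nat (quot_index b))) =
        twist n (int c) * of_nat c ^ n * (twist n (int (quot_index b)) * bernpoly n (of_nat F) (of_nat (quot_index b)))"
      unfolding tw by (simp only: mult_ac)
    finally show "chi (int b) * diamond p (int b) ^ n * (of_nat n * diff_ser c b (1 - of_nat n)) =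
        twist n (int c) * of_nat c ^ n * (twist n (int (quot_index b)) * bernpoly n (of_nat F) (of_nat (quot_index b)))
        - twist n (int b) * bernpoly n (of_nat F) (of_nat b)" .
  qed
  also have "\<dots> = twist n (int c) * of_nat c ^ n *
      (\<Sum>b\<in>units. twist n (int (quot_index b)) * bernpoly n (of_nat F) (of_nat (quot_index b))) - moment n * of_nat F"
    using F_nonzero by (simp add: sum_subtractf sum_distrib_left moment_def)
  also have "(\<Sum>b\<in>units. twist n (int (quot_index b)) * bernpoly n (of_nat F) (of_nat (quot_index b))) = moment n * of_nat F"
    using sum.reindex_bij_betw[OF bij_quot_index, of "\<lambda>b. twist n (int b) * bernpoly n (of_nat F) (of_nat b)"]
      F_nonzero by (simp add: moment_def)
  also have "twist n (int c) * of_nat c ^ n = chi (int c) * diamond_pow p (int c) (of_nat n)"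
    using chi_diamond_power[OF p_not_dvd_c, of n] by (simp add: diamond_pow_of_nat)
  finally have "of_nat n * H_ser c (1 - of_nat n) * (- of_nat F) =
      ((1 - chi (int c) * diamond_pow p (int c) (of_nat n)) * moment n) * (- of_nat F)"
    by (simp add: algebra_simps)
  then show ?thesis using F_nonzero by simp
qed

lemma Euler_analytic: "analytic_on_disc (padic_radius p) (\<lambda>s. - (1 - chi (int c) * diamond_pow p (int c) (1 - s)))"
  using analytic_diff[OF analytic_cmult[OF analytic_diamond_pow_one_minus[OF p_not_dvd_c]] analytic_const, of "chi (int c)" 1]
  by simp

text \<open>Stated for \<open>L_num\<close>, so that it is available before an L-function is known
  to exist.\<close>

lemma H_ser_L_num:
  assumes s: "pabs s < padic_radius p"
  shows "(s - 1) * H_ser c s = - (1 - chi (int c) * diamond_pow p (int c) (1 - s)) * L_num s"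
proof (rule analytic_eqI[OF _ _ padic_radius_gt_1 _ s])
  show "analytic_on_disc (padic_radius p) (\<lambda>s. (s - 1) * H_ser c s)"
    by (intro analytic_mult analytic_diff analytic_ident analytic_const H_ser_analytic)
  show "analytic_on_disc (padic_radius p) (\<lambda>s. - (1 - chi (int c) * diamond_pow p (int c) (1 - s)) * L_num s)"
    by (intro analytic_mult Euler_analytic L_num_analytic)
  fix n :: nat assume n: "n \<ge> 1"
  have a: "1 - (1 - of_nat n) = (of_nat n :: 'a)" by simp
  have b: "(1 - of_nat n - 1) * y = - (of_nat n * y)" for y :: 'a by simp
  show "(1 - of_nat n - 1) * H_ser c (1 - of_nat n) =
      - (1 - chi (int c) * diamond_pow p (int c) (1 - (1 - of_nat n))) * L_num (1 - of_nat n)"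
    unfolding a b H_ser_nat[OF n] L_num_nat[OF n] by (rule minus_mult_left)
qed

text \<open>For trivial \<open>chi\<close> the comparison is made after multiplication by s - 1,
  because there the analytic function is \<open>h\<close>, not \<open>L\<close>.\<close>

lemma H_ser_L:
  assumes L: "is_padic_L p chi L" and s: "pabs s < padic_radius p" "s \<noteq> 1 \<or> chi \<noteq> (\<lambda>_. 1)"
  shows "H_ser c s = - (1 - chi (int c) * diamond_pow p (int c) (1 - s)) * L s"
proof -
  have Ln: "of_nat n * L (1 - of_nat n) = - moment n" if n: "n \<ge> 1" for n
  proof -
    have aux: "of_nat n * (- x * (y / of_nat n)) = - (x * y)" for x y :: 'a using n by simp
    have "L (1 - of_nat n) = - (1 - char_twist p chi n (int p) * of_nat p ^ (n - 1))
          * (gen_bernoulli n (char_twist p chi n) / of_nat n)"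
      using L n unfolding is_padic_L_def by blast
    then show ?thesis unfolding moment_eq[OF n] by (simp only: aux)
  qed
  show ?thesis
  proof (cases "chi = (\<lambda>_. 1)")
    case False
    then have La: "analytic_on_disc (padic_radius p) L" using L by (simp add: is_padic_L_def)
    show ?thesis
    proof (rule analytic_eqI[OF H_ser_analytic analytic_mult[OF Euler_analytic La] padic_radius_gt_1 _ s(1)])
      fix n :: nat assume n: "n \<ge> 1"
      have aux: "of_nat n * (- x * L (1 - of_nat n)) = x * moment n" for x
        unfolding mult.left_commute[of "of_nat n"] Ln[OF n] by simp
      have "of_nat n * H_ser c (1 - of_nat n) =
          of_nat n * (- (1 - chi (int c) * diamond_pow p (int c) (1 - (1 - of_nat n))) * L (1 - of_nat n))"
        unfolding aux H_ser_nat[OF n] by simp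
      then show "H_ser c (1 - of_nat n) =
          - (1 - chi (int c) * diamond_pow p (int c) (1 - (1 - of_nat n))) * L (1 - of_nat n)"
        using n by simp
    qed
  next
    case True
    then obtain h where h: "analytic_on_disc (padic_radius p) h"
      "\<And>s. pabs s < padic_radius p \<Longrightarrow> s \<noteq> 1 \<Longrightarrow> L s = h s / (s - 1)"
      using L by (auto simp: is_padic_L_def)
    have "(s - 1) * H_ser c s = - (1 - chi (int c) * diamond_pow p (int c) (1 - s)) * h s"
    proof (rule analytic_eqI[OF _ analytic_mult[OF Euler_analytic h(1)] padic_radius_gt_1 _ s(1)])
      show "analytic_on_disc (padic_radius p) (\<lambda>s. (s - 1) * H_ser c s)"
        by (intro analytic_mult analytic_diff analytic_ident analytic_const H_ser_analytic)
      fix n :: nat assume n: "n \<ge> 1"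
      have "L (1 - of_nat n) = h (1 - of_nat n) / (- of_nat n)"
        using h(2)[OF pabs_one_minus_nat, of n] n by simp
      then have hn: "h (1 - of_nat n) = moment n" using Ln[OF n] n by (simp add: field_simps)
      have a: "1 - (1 - of_nat n) = (of_nat n :: 'a)" by simp
      have b: "(1 - of_nat n - 1) * y = - (of_nat n * y)" for y :: 'a by simp
      show "(1 - of_nat n - 1) * H_ser c (1 - of_nat n) =
          - (1 - chi (int c) * diamond_pow p (int c) (1 - (1 - of_nat n))) * h (1 - of_nat n)"
        unfolding a b hn H_ser_nat[OF n] by (rule minus_mult_left)
    qed
    moreover have "s \<noteq> 1" using s(2) True by simp
    ultimately have "H_ser c s = - (1 - chi (int c) * diamond_pow p (int c) (1 - s)) * h s / (s - 1)"
      by (metis nonzero_mult_div_cancel_left right_minus_eq)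
    then show ?thesis unfolding h(2)[OF s(1) \<open>s \<noteq> 1\<close>] by (simp only: times_divide_eq_right)
  qed
qed

text \<open>\<open>bernpoly 1 c k\<close> is k - c/2, and subtracting B_1 adds 1/2.\<close>

lemma diff_coeff_1: "diff_coeff c b (Suc 0) = - of_rat (eps (int b) c F)"
proof -
  have "eps (int b) c F = (of_nat c - 1) / 2 - of_nat (mult_index c b)"
    unfolding eps_def int_mult_index[symmetric] by simp
  then have "(of_rat (eps (int b) c F) :: 'a) = (of_nat c - 1) / 2 - of_nat (mult_index c b)"
    by (simp add: of_rat_diff of_rat_divide)
  then show ?thesis
    using bern_1[where 'a = 'a] by (simp add: diff_coeff_def bernpoly_def bern_0 diff_divide_distrib)
qed

lemma H_ser_approx:
  assumes s: "pabs s < padic_radius p"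
  shows "pabs (H_ser c s - (\<Sum>b\<in>units. chi (int b) * inverse (teich p (int b)) *
      diamond_pow p (int b) (- s) * of_rat (eps (int b) c F))) \<le> pabs (of_nat F / of_nat (padic_q p * p) :: 'a)"
proof -
  \<comment> \<open>For \<open>j \<ge> 1\<close>, two of the \<open>j + 1\<close> factors
    \<open>F\<close> are kept, the other \<open>j - 1\<close> are bounded by \<open>1 / q\<close>
    each, and the Bernoulli difference by \<open>p\<close>: together \<open>D / q ^ j\<close>. The
    final division by \<open>F\<close> leaves |F| q p, which is |F / (q p)|.\<close>
  define D where "D = pabs (of_nat F :: 'a) ^ 2 * real (padic_q p) * real p"
  define w where "w = (\<lambda>b j. (of_nat F / of_nat b) ^ Suc j * diff_coeff c b (Suc j))"
  have q: "real (padic_q p) > 0" using padic_q_pos by simp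
  have wD: "pabs (w b j) \<le> D / real (padic_q p) ^ j" if b: "b \<in> units" and j: "j \<ge> 1" for b j
  proof -
    obtain i where i: "j = Suc i" using j by (cases j) auto
    have "pabs (w b j) = pabs (of_nat F :: 'a) ^ 2 * pabs (of_nat F :: 'a) ^ i * pabs (diff_coeff c b (Suc j))"
      using units_D[OF b] by (simp add: w_def i pabs_mult pabs_power pabs_divide power2_eq_square)
    also have "\<dots> \<le> pabs (of_nat F :: 'a) ^ 2 * (1 / real (padic_q p)) ^ i * real p"
      by (intro mult_mono power_mono pabs_F diff_coeff_le order_refl) auto
    also have "\<dots> = D / real (padic_q p) ^ j" using q by (simp add: D_def i power_divide)
    finally show ?thesis .
  qed
  have wC: "pabs (w b j) \<le> real p / real (padic_q p) ^ j" if "b \<in> units" for b j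
    unfolding w_def by (rule diff_ser_bound[OF that])
  \<comment> \<open>\<open>diamond p b / b\<close> is \<open>1 / teich p b\<close>, and the sign of
    \<open>- of_nat F\<close> cancels that of \<open>diff_coeff_1\<close>.\<close>
  have main: "chi (int b) * inverse (teich p (int b)) * diamond_pow p (int b) (- s) * of_rat (eps (int b) c F) =
      chi (int b) * diamond_pow p (int b) (1 - s) * w b 0 / (- of_nat F)" if b: "b \<in> units" for b
    using diamond_pow_shift[OF units_D(4)[OF b] s] units_D(5)[OF b] F_nonzero
    by (simp add: w_def diff_coeff_1 diamond_def field_simps)
  have 1: "(\<Sum>b\<in>units. chi (int b) * inverse (teich p (int b)) *
      diamond_pow p (int b) (- s) * of_rat (eps (int b) c F)) =
      (\<Sum>b\<in>units. chi (int b) * diamond_pow p (int b) (1 - s) * w b 0) / (- of_nat F)"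
    unfolding sum_divide_distrib by (intro sum.cong refl main)
  have 2: "H_ser c s = (\<Sum>b\<in>units. chi (int b) * diamond_pow p (int b) (1 - s) * binser (w b) s) / (- of_nat F)"
    by (simp only: H_ser_def diff_ser_def w_def)
  have "H_ser c s - (\<Sum>b\<in>units. chi (int b) * inverse (teich p (int b)) *
      diamond_pow p (int b) (- s) * of_rat (eps (int b) c F)) =
      (\<Sum>b\<in>units. chi (int b) * diamond_pow p (int b) (1 - s) * (binser (w b) s - w b 0)) / (- of_nat F)"
    unfolding 1 2
    by (simp only: diff_divide_distrib[symmetric] sum_subtractf[symmetric] right_diff_distrib[symmetric])
  also have "pabs \<dots> \<le> D / pabs (of_nat F :: 'a)"
    unfolding pabs_divide pabs_minus
  proof (intro divide_right_mono pabs_sum_le zero_le_dist)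
    show "D \<ge> 0" by (simp add: D_def)
    fix b assume b: "b \<in> units"
    have "pabs (binser (w b) s - w b 0) \<le> D"
      by (rule binser_tail_le[OF wC[OF b] wD[OF b] \<open>D \<ge> 0\<close> s])
    then have "pabs (chi (int b)) * pabs (diamond_pow p (int b) (1 - s)) * pabs (binser (w b) s - w b 0) \<le> 1 * 1 * D"
      using \<open>D \<ge> 0\<close>
      by (intro mult_mono pabs_dirichlet_char[OF chi] pabs_diamond_pow_one_minus units_D(4)[OF b] s) auto
    then show "pabs (chi (int b) * diamond_pow p (int b) (1 - s) * (binser (w b) s - w b 0)) \<le> D"
      by (simp add: pabs_mult)
  qed
  also have "D / pabs (of_nat F :: 'a) = pabs (of_nat F :: 'a) * real (padic_q p) * real p"
    using F_nonzero by (simp add: D_def power2_eq_square)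
  also have "\<dots> = pabs (of_nat F / of_nat (padic_q p * p) :: 'a)"
    by (simp add: pabs_divide pabs_mult pabs_padic_q pabs_p)
  finally show ?thesis .
qed

end

text \<open>In place of orthogonality of characters: at \<open>s = 1\<close> the left side of
  \<open>H_ser_L_num\<close> vanishes, so a \<open>c\<close> with \<open>chi c \<noteq> 1\<close>
  forces \<open>L_num 1 = 0\<close>.\<close>

lemma L_res_eq_0:
  assumes "chi \<noteq> (\<lambda>_. 1)"
  shows "L_res = 0"
proof -
  obtain c where c: "c > 1" "coprime c F" "chi (int c) \<noteq> 1"
  proof (rule ccontr)
    assume no: "\<not> thesis"
    note ex = that
    have triv: "chi a = 1" if a: "chi a \<noteq> 0" for a
    proof -
      have "coprime a (int f)" using a dirichlet_char_eq_0_iff[OF chi] by blast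
      then obtain b where b: "[b = a] (mod int f)" "coprime b (int f * int F)"
        by (rule coprime_lift) (use F_pos in auto)
      \<comment> \<open>Adding \<open>F\<close> keeps the residue class and ensures
        \<open>c > 1\<close>.\<close>
      define c where "c = nat (b mod int F) + F"
      have "F \<noteq> 1" using p_dvd_F prime_gt_1_nat[OF prime_p] by auto
      then have "c > 1" using F_pos by (simp add: c_def)
      have "int c = b mod int F + int F" using F_pos by (simp add: c_def)
      then have cb: "[int c = b] (mod int F)" by (simp add: cong_def)
      have "coprime (int c) (int F)" using b(2) by (intro cong_imp_coprime[OF cong_sym[OF cb]]) simp
      then have "chi (int c) = 1" using ex[of c] no \<open>c > 1\<close> by auto
      moreover have "[int c = a] (mod int f)"
        using f_dvd_F by (intro cong_trans[OF cong_dvd_modulus[OF cb] b(1)]) simp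
      ultimately show ?thesis using dirichlet_char_cong[OF chi] by metis
    qed
    \<comment> \<open>If all nonzero values are 1, the conductor is 1; as \<open>chi\<close> is
      primitive, its modulus is then 1 and no value is 0.\<close>
    have "conductor chi \<le> 1"
      by (rule conductor_le[of 1 "\<lambda>_. 1"]) (use triv in \<open>simp_all add: dirichlet_char_def\<close>)
    then have "f = 1" using conductor_chi dirichlet_char_pos[OF chi] by simp
    then have "chi a \<noteq> 0" for a using dirichlet_char_eq_0_iff[OF chi, of a] by simp
    then have "chi = (\<lambda>_. 1)" using triv by auto
    then show False using assms by simp
  qed
  have 1: "pabs (1::'a) < padic_radius p" using padic_radius_gt_1 by (simp add: pabs_one)
  have "diamond_pow p (int c) (0::'a) = 1" using diamond_pow_of_nat[of "int c" 0] by simp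
  then have "(1 - chi (int c)) * L_num 1 = 0" using H_ser_L_num[OF c(1,2) 1] by simp
  then show ?thesis using c(3) L_num_eq[OF 1] by simp
qed

text \<open>The choice in \<open>padic_L\<close> needs a witness. For nontrivial \<open>chi\<close>
  the residue vanishes and the regular part serves. For trivial \<open>chi\<close> the value of
  \<open>L_num\<close> at 1 is the number of \<open>units\<close> divided by \<open>F\<close>,
  nonzero in characteristic 0, which gives the required simple pole.\<close>

lemma is_padic_L_exists: "\<exists>L. is_padic_L p chi L"
proof -
  have val: "x / (- of_nat n) = - y * (z / of_nat n)" if "x = y * z" for x y z :: 'a and n
    using that by simp
  show ?thesis
  proof (cases "chi = (\<lambda>_. 1)")
    case False
    have "L_reg (1 - of_nat n) = moment n / (- of_nat n)" if n: "n \<ge> 1" for n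
    proof -
      have "moment n = (1 - of_nat n - 1) * L_reg (1 - of_nat n)"
        using L_num_eq[OF pabs_one_minus_nat, of n] L_res_eq_0[OF False] L_num_nat[OF n] by simp
      then show ?thesis using n by simp
    qed
    then have "is_padic_L p chi L_reg"
      unfolding is_padic_L_def using False L_reg_analytic val[OF moment_eq] by simp
    then show ?thesis by (rule exI[of _ L_reg])
  next
    case True
    have "1 \<in> units" using F_pos prime_gt_1_nat[OF prime_p] by (auto simp: units_def)
    moreover have "finite units" by (simp add: units_def)
    ultimately have "card units \<noteq> 0" by auto
    moreover have "L_res = of_nat (card units) / of_nat F"
      unfolding L_res_def using True by simp
    ultimately have "L_res \<noteq> 0" using F_nonzero by simp
    moreover have "pabs (1::'a) < padic_radius p" using padic_radius_gt_1 by (simp add: pabs_one)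
    ultimately have "L_num 1 \<noteq> 0" using L_num_eq[of 1] by simp
    moreover have "L_num (1 - of_nat n) / (1 - of_nat n - 1) = moment n / (- of_nat n)" if n: "n \<ge> 1" for n
      using L_num_nat[OF n] by simp
    ultimately have "is_padic_L p chi (\<lambda>s. L_num s / (s - 1))"
      unfolding is_padic_L_def using True L_num_analytic val[OF moment_eq] by auto
    then show ?thesis by (rule exI[of _ "\<lambda>s. L_num s / (s - 1)"])
  qed
qed

lemma padic_L_is_padic_L: "is_padic_L p chi (\<lambda>s. padic_L p s chi)"
  unfolding padic_L_def using someI_ex[OF is_padic_L_exists] by simp

end

theorem theorem2p4:
  fixes p f F c :: nat
    and chi :: "int \<Rightarrow> 'a::{alg_closed_field,field_char_0,complete_space}"
  assumes "prime p"
    and "is_Cp p TYPE('a)"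
    and "dirichlet_char f chi" and "conductor chi = f"
    and "chi (- 1) = 1"
    and "F > 0" and "padic_q p dvd F" and "f dvd F"
    and "c > 1" and "coprime c F"
  shows "(\<forall>a. eps a c F \<in> {- ((of_nat c - 1) / 2) + of_nat k | k. k < c}) \<and>
    (\<exists>H. analytic_on_disc (padic_radius p) H \<and>
       (\<forall>s. pabs s < padic_radius p \<and> (s \<noteq> 1 \<or> chi \<noteq> (\<lambda>_. 1)) \<longrightarrow>
          H s = - (1 - chi (int c) * diamond_pow p (int c) (1 - s)) * padic_L p s chi) \<and>
       (\<forall>s. pabs s < padic_radius p \<longrightarrow>
          pabs (H s - (\<Sum>a | a \<in> {1..int F} \<and> \<not> int p dvd a.
                  chi a * inverse (teich p a) * diamond_pow p a (- s) * of_rat (eps a c F)))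
            \<le> pabs (of_nat F / of_nat (padic_q p * p) :: 'a)))"
proof -
  interpret padic_L_setup p "TYPE('a)" f F chi
    using assms unfolding is_Cp_def by unfold_locales blast+
  have "eps a c F \<in> {- ((of_nat c - 1) / 2) + of_nat k | k. k < c}" for a
  proof -
    define m where "m = (- a * modular_inverse (int c) (int F)) mod int c"
    have m: "0 \<le> m" "m < int c" using assms(9) by (simp_all add: m_def)
    \<comment> \<open>The index is \<open>c - 1 - m\<close>, because (c - 1)/2 - m = -(c - 1)/2 + (c
      - 1 - m).\<close>
    have "(of_nat (c - 1 - nat m) :: rat) = of_nat c - 1 - of_int m"
      using m assms(9) by (simp add: of_nat_diff)
    then have "eps a c F = - ((of_nat c - 1) / 2) + of_nat (c - 1 - nat m)"
      unfolding eps_def m_def[symmetric] by (simp add: field_simps)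
    moreover have "c - 1 - nat m < c" using assms(9) by simp
    ultimately show ?thesis by blast
  qed
  moreover have "{a \<in> {1..int F}. \<not> int p dvd a} = int ` units"
  proof (intro equalityI subsetI)
    fix a assume "a \<in> {a \<in> {1..int F}. \<not> int p dvd a}"
    then have "a = int (nat a)" "nat a \<in> units"
      using int_dvd_int_iff[of p "nat a"] by (auto simp: units_def)
    then show "a \<in> int ` units" by (rule image_eqI)
  qed (auto simp: units_def)
  then have sum_eq: "(\<Sum>a | a \<in> {1..int F} \<and> \<not> int p dvd a. g a) = (\<Sum>b\<in>units. g (int b))" for g :: "int \<Rightarrow> 'a"
    by (simp add: sum.reindex)
  ultimately show ?thesis
    using H_ser_analytic[of c] H_ser_L[OF assms(9,10) padic_L_is_padic_L] H_ser_approx[OF assms(9,10)]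
    unfolding sum_eq by (intro conjI allI exI[of _ "H_ser c"] impI) auto
qed

end
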